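(* Let $(b,c)$ be a connected canonically compactifiable weighted graph over $X$. Then for every $\varphi\in C_0(\partial X)$ there exists a unique $u\in\mathcal A$ such that $$\mathcal Lu=0\ \text{ on }X\qquad\text{and}\qquad \hat u|_{\partial X}=\varphi.$$
   Context: Let $X$ be a countably infinite set. A weighted graph $(b,c)$ over $X$ consists of a symmetric $b:X\times X\to[0,\infty)$ with $b(x,x)=0$ and $\sum_{y}b(x,y)<\infty$ for all $x$, and $c:X\to[0,\infty)$; connected means any two distinct vertices are joined by a finite path of pairwise distinct vertices with consecutive ones satisfying $b>0$. For bounded $f$, $\mathcal Lf(x)=\sum_y b(x,y)(f(x)-f(y))+c(x)f(x)$. Let $\widetilde Q(f)=\frac12\sum_{x,y}b(x,y)|f(x)-f(y)|^2+\sum_x c(x)|f(x)|^2$ and $\widetilde D=\{f:\widetilde Q(f)<\infty\}$; the graph is canonically compactifiable if $\widetilde D\subseteq\ell^\infty(X)$. Let $\mathcal A$ be the sup-norm closure of $\widetilde D$ in $\ell^\infty(X)$, $\mathcal A^+$ the smallest $C^*$-subalgebra of $\ell^\infty(X)$ containing $\mathcal A$ and $1$, $K$ the set of characters (nonzero multiplicative linear functionals) of $\mathcal A^+$ with the weak-$*$ topology, and $\hat g(\gamma)=\gamma(g)$. Via $x\mapsto\delta_x$ ($\delta_x(f)=f(x)$) view $X\subseteq K$ and set $\partial X=K\setminus X$. If $\sum_x c(x)<\infty$, set $C_0(\partial X)=C(\partial X)$. Otherwise $1\notin\mathcal A$, there is a character $\gamma_\infty\in\partial X$ defined by $\gamma_\infty(g+\alpha1)=\alpha$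 for $g\in\mathcal A$, $\alpha\in\mathbb C$, and $C_0(\partial X)=\{\varphi\in C(\partial X):\varphi(\gamma_\infty)=0\}$. *)

theory Defs
  imports "HOL-Analysis.Analysis"
begin

text \<open>Vertex set X is a type 'x (countably infinite, assumed in the theorem).
  Functions on X are complex valued; \<ell>^\<infinity>(X) = bounded functions with sup norm.\<close>

definition weighted_graph :: "('x \<Rightarrow> 'x \<Rightarrow> real) \<Rightarrow> ('x \<Rightarrow> real) \<Rightarrow> bool" where
  "weighted_graph b c \<longleftrightarrow>
     (\<forall>x y. b x y \<ge> 0) \<and> (\<forall>x y. b x y = b y x) \<and> (\<forall>x. b x x = 0) \<and>
     (\<forall>x. b x summable_on UNIV) \<and> (\<forall>x. c x \<ge> 0)"

definition graph_connected :: "('x \<Rightarrow> 'x \<Rightarrow> real) \<Rightarrow> bool" where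
  "graph_connected b \<longleftrightarrow>
     (\<forall>x y. x \<noteq> y \<longrightarrow> (\<exists>p :: 'x list. p \<noteq> [] \<and> hd p = x \<and> last p = y \<and> distinct p \<and>
        (\<forall>i. Suc i < length p \<longrightarrow> b (p ! i) (p ! Suc i) > 0)))"

definition linfty :: "('x \<Rightarrow> complex) set" where
  "linfty = {f. bounded (range f)}"

text \<open>\<open>f \<in> Dtilde b c\<close> iff \<open>Q~(f) < \<infinity>\<close> (both sums of nonnegative terms are finite).\<close>
definition Dtilde :: "('x \<Rightarrow> 'x \<Rightarrow> real) \<Rightarrow> ('x \<Rightarrow> real) \<Rightarrow> ('x \<Rightarrow> complex) set" where
  "Dtilde b c = {f. (\<lambda>(x, y). b x y * (cmod (f x - f y))\<^sup>2) summable_on UNIV \<and>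
                    (\<lambda>x. c x * (cmod (f x))\<^sup>2) summable_on UNIV}"

definition canonically_compactifiable :: "('x \<Rightarrow> 'x \<Rightarrow> real) \<Rightarrow> ('x \<Rightarrow> real) \<Rightarrow> bool" where
  "canonically_compactifiable b c \<longleftrightarrow> Dtilde b c \<subseteq> linfty"

definition sup_closure :: "('x \<Rightarrow> complex) set \<Rightarrow> ('x \<Rightarrow> complex) set" where
  "sup_closure S = {f \<in> linfty. \<forall>e>0. \<exists>g\<in>S \<inter> linfty. \<forall>x. cmod (f x - g x) \<le> e}"

definition Aalg :: "('x \<Rightarrow> 'x \<Rightarrow> real) \<Rightarrow> ('x \<Rightarrow> real) \<Rightarrow> ('x \<Rightarrow> complex) set" where
  "Aalg b c = sup_closure (Dtilde b c)"

definition cstar_subalgebra :: "('x \<Rightarrow> complex) set \<Rightarrow> bool" where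
  "cstar_subalgebra S \<longleftrightarrow> S \<subseteq> linfty \<and> (\<lambda>_. 0) \<in> S \<and>
     (\<forall>f\<in>S. \<forall>g\<in>S. (\<lambda>x. f x + g x) \<in> S \<and> (\<lambda>x. f x * g x) \<in> S) \<and>
     (\<forall>f\<in>S. \<forall>a::complex. (\<lambda>x. a * f x) \<in> S) \<and>
     (\<forall>f\<in>S. (\<lambda>x. cnj (f x)) \<in> S) \<and>
     sup_closure S \<subseteq> S"

definition Aplus :: "('x \<Rightarrow> 'x \<Rightarrow> real) \<Rightarrow> ('x \<Rightarrow> real) \<Rightarrow> ('x \<Rightarrow> complex) set" where
  "Aplus b c = \<Inter>{S. cstar_subalgebra S \<and> Aalg b c \<subseteq> S \<and> (\<lambda>_. 1) \<in> S}"

definition characters :: "('x \<Rightarrow> 'x \<Rightarrow> real) \<Rightarrow> ('x \<Rightarrow> real) \<Rightarrow> (('x \<Rightarrow> complex) \<Rightarrow> complex) set" where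
  "characters b c = {\<gamma>. \<gamma> \<in> extensional (Aplus b c) \<and>
     (\<forall>f\<in>Aplus b c. \<forall>g\<in>Aplus b c. \<gamma> (\<lambda>x. f x + g x) = \<gamma> f + \<gamma> g \<and>
                                     \<gamma> (\<lambda>x. f x * g x) = \<gamma> f * \<gamma> g) \<and>
     (\<forall>f\<in>Aplus b c. \<forall>a::complex. \<gamma> (\<lambda>x. a * f x) = a * \<gamma> f) \<and>
     (\<exists>f\<in>Aplus b c. \<gamma> f \<noteq> 0)}"

definition weakstar_top :: "('x \<Rightarrow> 'x \<Rightarrow> real) \<Rightarrow> ('x \<Rightarrow> real) \<Rightarrow> (('x \<Rightarrow> complex) \<Rightarrow> complex) topology" where
  "weakstar_top b c = subtopology (product_topology (\<lambda>_. euclidean) (Aplus b c)) (characters b c)"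

definition delta_char :: "('x \<Rightarrow> 'x \<Rightarrow> real) \<Rightarrow> ('x \<Rightarrow> real) \<Rightarrow> 'x \<Rightarrow> (('x \<Rightarrow> complex) \<Rightarrow> complex)" where
  "delta_char b c x = restrict (\<lambda>f. f x) (Aplus b c)"

definition boundary :: "('x \<Rightarrow> 'x \<Rightarrow> real) \<Rightarrow> ('x \<Rightarrow> real) \<Rightarrow> (('x \<Rightarrow> complex) \<Rightarrow> complex) set" where
  "boundary b c = characters b c - range (delta_char b c)"

text \<open>\<gamma>_\<infinity>(g + \<alpha> 1) = \<alpha> for g \<in> A (used when \<Sum> c = \<infinity>).\<close>
definition gamma_infty :: "('x \<Rightarrow> 'x \<Rightarrow> real) \<Rightarrow> ('x \<Rightarrow> real) \<Rightarrow> (('x \<Rightarrow> complex) \<Rightarrow> complex)" where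
  "gamma_infty b c = restrict (\<lambda>f. THE \<alpha>. \<exists>g\<in>Aalg b c. f = (\<lambda>x. g x + \<alpha>)) (Aplus b c)"

definition C_boundary :: "('x \<Rightarrow> 'x \<Rightarrow> real) \<Rightarrow> ('x \<Rightarrow> real) \<Rightarrow> ((('x \<Rightarrow> complex) \<Rightarrow> complex) \<Rightarrow> complex) set" where
  "C_boundary b c = {\<phi>. continuous_map (subtopology (weakstar_top b c) (boundary b c)) euclidean \<phi>}"

definition C0_boundary :: "('x \<Rightarrow> 'x \<Rightarrow> real) \<Rightarrow> ('x \<Rightarrow> real) \<Rightarrow> ((('x \<Rightarrow> complex) \<Rightarrow> complex) \<Rightarrow> complex) set" where
  "C0_boundary b c = (if c summable_on UNIV then C_boundary b c
                      else {\<phi> \<in> C_boundary b c. \<phi> (gamma_infty b c) = 0})"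

definition Lap :: "('x \<Rightarrow> 'x \<Rightarrow> real) \<Rightarrow> ('x \<Rightarrow> real) \<Rightarrow> ('x \<Rightarrow> complex) \<Rightarrow> 'x \<Rightarrow> complex" where
  "Lap b c f x = (\<Sum>\<^sub>\<infinity>y. complex_of_real (b x y) * (f x - f y)) + complex_of_real (c x) * f x"

end

theory Submission
  imports Defs
begin

text \<open>Uniqueness is a maximum principle: if \<open>\<bar>\<gamma> u\<bar> \<le> s\<close> for all boundary characters, then by compactness of
  the space of characters the sets \<open>{\<bar>u\<bar> \<ge> t}\<close>, \<open>t > s\<close>, are finite, so a harmonic \<open>u\<close> exceeding \<open>s\<close> would
  attain its maximum modulus and be constant in modulus on the infinite set \<open>X\<close>. It also shows that
  uniformly convergent boundary data yield uniformly convergent solutions; as the functions of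
  finite energy are dense in the admissible boundary data (Stone--Weierstrass), it remains to solve
  the problem for \<open>f\<close> of finite energy. There, minimise the energy of \<open>f - g\<close> over finitely
  supported \<open>g\<close>. Since the graph is canonically compactifiable, the energy of finitely supported
  functions controls their supremum norm, so a minimising sequence converges uniformly; its limit
  is harmonic by the first variation, and finitely supported functions vanish on the boundary.\<close>

text \<open>No Gelfand isomorphism is needed: boundary data need only be approximated by boundary
  values of the algebra, because the maximum principle turns approximate data into a uniform Cauchy
  sequence and \<open>Aalg\<close> is uniformly closed. Likewise the minimising sequence is followed
  only in the supremum norm; no minimiser of finite energy is produced and no Hilbert space is
  completed. Two obstacles shape the proof. Energy is only a seminorm: when c = 0, constants have
  energy zero. Finite support removes this defect, since on an infinite X every finitely supported
  function has a zero. Passing from pointwise to uniform control then uses canonical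
  compactifiability a second time; its first use is that products of functions of finite energy have
  finite energy. The other obstacle is the missing unit when the sum of c diverges:
  Stone--Weierstrass yields approximants in \<open>Aplus\<close>, that is, in \<open>Aalg\<close>
  plus constants, and the vanishing of \<phi> at \<open>gamma_infty\<close> is what makes the
  constant part small.\<close>

section \<open>Function spaces are Hausdorff\<close>

text \<open>Stone--Weierstrass, in the form of the locale \<open>function_ring_on\<close>, asks for
  a Hausdorff domain type. Here the domain consists of functionals on
  \<open>'x \<Rightarrow> complex\<close>, an uncountable index type, so the product topology has to
  be recognised as Hausdorff directly.\<close>

lemma fun_hausdorff:
  fixes f g :: "'a \<Rightarrow> 'b::t2_space"
  assumes "f \<noteq> g"
  shows "\<exists>U V. open U \<and> open V \<and> f \<in> U \<and> g \<in> V \<and> U \<inter> V = {}"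
proof -
  from assms obtain i where "f i \<noteq> g i" by auto
  then obtain U V where UV: "open U" "open V" "f i \<in> U" "g i \<in> V" "U \<inter> V = {}"
    using hausdorff by metis
  have cont: "continuous_on UNIV (\<lambda>h :: 'a \<Rightarrow> 'b. h i)" by simp
  have "open ((\<lambda>h. h i) -` U)" "open ((\<lambda>h. h i) -` V)"
    using open_vimage[OF UV(1) cont] open_vimage[OF UV(2) cont] by auto
  moreover have "f \<in> (\<lambda>h. h i) -` U" "g \<in> (\<lambda>h. h i) -` V"
    "((\<lambda>h. h i) -` U) \<inter> ((\<lambda>h. h i) -` V) = {}"
    using UV by auto
  ultimately show ?thesis by blast
qed

text \<open>The library has these instances only for a countable index type, via the metric; they have to be
  generalised in the order \<open>t0\<close>, \<open>t1\<close>, \<open>t2\<close> to keep the arities coregular.\<close>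

instance "fun" :: (type, t2_space) t0_space
  by standard (metis fun_hausdorff IntI empty_iff)
instance "fun" :: (type, t2_space) t1_space
  by standard (metis fun_hausdorff IntI empty_iff)
instance "fun" :: (type, t2_space) t2_space
  by standard (rule fun_hausdorff)

section \<open>Uniformly closed algebras of bounded functions\<close>

lemma linfty_iff: "f \<in> linfty \<longleftrightarrow> (\<exists>M. \<forall>x. cmod (f x) \<le> M)"
  by (auto simp: linfty_def bounded_iff)

lemma sup_closureD:
  assumes "f \<in> sup_closure S" "e > 0"
  obtains g where "g \<in> S" "\<And>x. cmod (f x - g x) \<le> e"
  using assms unfolding sup_closure_def by blast

text \<open>Boundedness of f is part of \<open>sup_closure\<close> but comes for free: an
  approximation within 1 by a bounded function already gives it.\<close>

lemma sup_closureI: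
  assumes "S \<subseteq> linfty" "\<And>e. e > 0 \<Longrightarrow> \<exists>g\<in>S. \<forall>x. cmod (f x - g x) \<le> e"
  shows "f \<in> sup_closure S"
proof -
  obtain g where g: "g \<in> S" "\<forall>x. cmod (f x - g x) \<le> 1"
    using assms(2)[of 1] by auto
  then obtain M where M: "\<And>x. cmod (g x) \<le> M"
    using assms(1) linfty_iff by blast
  have "cmod (f x) \<le> M + 1" for x
    using M[of x] g(2)[rule_format, of x] norm_triangle_ineq2[of "f x" "g x"] by linarith
  then have "f \<in> linfty"
    by (auto simp: linfty_iff)
  then show ?thesis
    using assms by (auto simp: sup_closure_def Int_absorb2)
qed

lemma subset_sup_closure: "S \<subseteq> linfty \<Longrightarrow> S \<subseteq> sup_closure S"
  by (intro subsetI sup_closureI) (auto intro!: bexI)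

lemma sup_closure_linfty: "sup_closure S \<subseteq> linfty"
  by (auto simp: sup_closure_def)

lemma sup_closure_mono: "S \<subseteq> T \<Longrightarrow> sup_closure S \<subseteq> sup_closure T"
  unfolding sup_closure_def by fast

lemma sup_closure_idem:
  assumes "S \<subseteq> linfty"
  shows "sup_closure (sup_closure S) \<subseteq> sup_closure S"
proof
  fix f assume f: "f \<in> sup_closure (sup_closure S)"
  show "f \<in> sup_closure S"
  proof (rule sup_closureI[OF assms])
    fix e :: real assume "e > 0"
    obtain g where g: "g \<in> sup_closure S" "\<And>x. cmod (f x - g x) \<le> e/2"
      using sup_closureD[OF f, of "e/2"] \<open>e > 0\<close> by auto
    obtain h where h: "h \<in> S" "\<And>x. cmod (g x - h x) \<le> e/2"
      using sup_closureD[OF g(1), of "e/2"] \<open>e > 0\<close> by auto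
    have "cmod (f x - h x) \<le> e" for x
      using g(2)[of x] h(2)[of x] norm_triangle_ineq[of "f x - g x" "g x - h x"] by simp
    then show "\<exists>g\<in>S. \<forall>x. cmod (f x - g x) \<le> e" using h by blast
  qed
qed

lemma cstar_subalgebra_add: "cstar_subalgebra S \<Longrightarrow> f \<in> S \<Longrightarrow> g \<in> S \<Longrightarrow> (\<lambda>x. f x + g x) \<in> S"
  and cstar_subalgebra_scale: "cstar_subalgebra S \<Longrightarrow> f \<in> S \<Longrightarrow> (\<lambda>x. a * f x) \<in> S"
  by (simp_all add: cstar_subalgebra_def)

lemma cstar_subalgebra_sup_closure:
  assumes S: "S \<subseteq> linfty" and zero: "(\<lambda>_. 0) \<in> S"
    and add: "\<And>f g. f \<in> S \<Longrightarrow> g \<in> S \<Longrightarrow> (\<lambda>x. f x + g x) \<in> S"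
    and mult: "\<And>f g. f \<in> S \<Longrightarrow> g \<in> S \<Longrightarrow> (\<lambda>x. f x * g x) \<in> S"
    and scale: "\<And>f a. f \<in> S \<Longrightarrow> (\<lambda>x. a * f x) \<in> S"
    and cnj: "\<And>f. f \<in> S \<Longrightarrow> (\<lambda>x. cnj (f x)) \<in> S"
  shows "cstar_subalgebra (sup_closure S)"
  unfolding cstar_subalgebra_def
proof (intro conjI ballI allI)
  show "sup_closure S \<subseteq> linfty" by (rule sup_closure_linfty)
  show "sup_closure (sup_closure S) \<subseteq> sup_closure S" by (rule sup_closure_idem[OF S])
  show "(\<lambda>_. 0) \<in> sup_closure S" using zero subset_sup_closure[OF S] by blast
  fix f assume f: "f \<in> sup_closure S"
  then obtain M where M: "\<And>x. cmod (f x) \<le> M"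
    using sup_closure_linfty linfty_iff by blast
  then have "M \<ge> 0" using norm_ge_zero order_trans by blast
  show "(\<lambda>x. cnj (f x)) \<in> sup_closure S"
  proof (rule sup_closureI[OF S])
    fix e :: real assume "e > 0"
    obtain g where g: "g \<in> S" "\<And>x. cmod (f x - g x) \<le> e"
      using sup_closureD[OF f, of e] \<open>e > 0\<close> by auto
    have "cmod (cnj (f x) - cnj (g x)) \<le> e" for x
      using g(2)[of x] by (metis complex_cnj_diff complex_mod_cnj)
    then show "\<exists>g\<in>S. \<forall>x. cmod (cnj (f x) - g x) \<le> e"
      by (intro bexI[OF _ cnj[OF g(1)]]) auto
  qed
  show "(\<lambda>x. a * f x) \<in> sup_closure S" for a
  proof (rule sup_closureI[OF S])
    fix e :: real assume "e > 0"
    obtain g where g: "g \<in> S" "\<And>x. cmod (f x - g x) \<le> e / (cmod a + 1)"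
      using sup_closureD[OF f, of "e / (cmod a + 1)"] \<open>e > 0\<close>
      by (metis add_nonneg_pos divide_pos_pos norm_ge_zero zero_less_one)
    have "cmod (a * f x - a * g x) \<le> e" for x
    proof -
      have "cmod (a * f x - a * g x) = cmod a * cmod (f x - g x)"
        by (metis norm_mult right_diff_distrib)
      also have "\<dots> \<le> (cmod a + 1) * (e / (cmod a + 1))"
        using g(2)[of x] by (intro mult_mono) auto
      also have "\<dots> = e" by (simp add: add_nonneg_eq_0_iff)
      finally show ?thesis .
    qed
    then show "\<exists>g\<in>S. \<forall>x. cmod (a * f x - g x) \<le> e"
      by (intro bexI[OF _ scale[OF g(1)]]) auto
  qed
  fix g assume g: "g \<in> sup_closure S"
  then obtain N where N: "\<And>x. cmod (g x) \<le> N"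
    using sup_closure_linfty linfty_iff by blast
  then have "N \<ge> 0" using norm_ge_zero order_trans by blast
  show "(\<lambda>x. f x + g x) \<in> sup_closure S"
  proof (rule sup_closureI[OF S])
    fix e :: real assume "e > 0"
    obtain f' where f': "f' \<in> S" "\<And>x. cmod (f x - f' x) \<le> e/2"
      using sup_closureD[OF f, of "e/2"] \<open>e > 0\<close> by auto
    obtain g' where g': "g' \<in> S" "\<And>x. cmod (g x - g' x) \<le> e/2"
      using sup_closureD[OF g, of "e/2"] \<open>e > 0\<close> by auto
    have "cmod (f x + g x - (f' x + g' x)) \<le> e" for x
      using f'(2)[of x] g'(2)[of x] norm_triangle_ineq[of "f x - f' x" "g x - g' x"]
      by (simp add: algebra_simps)
    then show "\<exists>h\<in>S. \<forall>x. cmod (f x + g x - h x) \<le> e"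
      by (intro bexI[OF _ add[OF f'(1) g'(1)]]) auto
  qed
  show "(\<lambda>x. f x * g x) \<in> sup_closure S"
  proof (rule sup_closureI[OF S])
    fix e :: real assume "e > 0"
    \<comment> \<open>The bound 1 keeps the approximant of g below N + 1; the product error is then
      at most M d + (N + 1) d.\<close>
    define d where "d = min 1 (e / (M + N + 1))"
    have d: "d > 0" "d \<le> 1" "d \<le> e / (M + N + 1)"
      using \<open>e > 0\<close> \<open>M \<ge> 0\<close> \<open>N \<ge> 0\<close> by (auto simp: d_def)
    obtain f' where f': "f' \<in> S" "\<And>x. cmod (f x - f' x) \<le> d"
      using sup_closureD[OF f d(1)] by auto
    obtain g' where g': "g' \<in> S" "\<And>x. cmod (g x - g' x) \<le> d"
      using sup_closureD[OF g d(1)] by auto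
    have "cmod (f x * g x - f' x * g' x) \<le> e" for x
    proof -
      have "f x * g x - f' x * g' x = f x * (g x - g' x) + g' x * (f x - f' x)"
        by (simp add: algebra_simps)
      then have "cmod (f x * g x - f' x * g' x)
          \<le> cmod (f x) * cmod (g x - g' x) + cmod (g' x) * cmod (f x - f' x)"
        by (metis norm_triangle_ineq norm_mult)
      also have "cmod (g' x) \<le> N + 1"
        using N[of x] g'(2)[of x] d(2) norm_triangle_ineq2[of "g' x" "g x"]
        by (simp add: norm_minus_commute)
      then have "cmod (f x) * cmod (g x - g' x) + cmod (g' x) * cmod (f x - f' x)
          \<le> M * d + (N + 1) * d"
        using M[of x] f'(2)[of x] g'(2)[of x] \<open>M \<ge> 0\<close> \<open>N \<ge> 0\<close>
        by (intro add_mono mult_mono) auto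
      also have "\<dots> = (M + N + 1) * d" by (simp add: algebra_simps)
      also have "\<dots> \<le> e"
        using d(3) \<open>M \<ge> 0\<close> \<open>N \<ge> 0\<close> by (simp add: pos_le_divide_eq mult.commute)
      finally show ?thesis .
    qed
    then show "\<exists>h\<in>S. \<forall>x. cmod (f x * g x - h x) \<le> e"
      by (intro bexI[OF _ mult[OF f'(1) g'(1)]]) auto
  qed
qed

section \<open>Functions of finite energy\<close>

locale compactifiable_graph =
  fixes b :: "'x \<Rightarrow> 'x \<Rightarrow> real" and c :: "'x \<Rightarrow> real"
  assumes graph: "weighted_graph b c"
    and connected: "graph_connected b"
    and compactifiable: "canonically_compactifiable b c"
    and infinite_UNIV: "infinite (UNIV :: 'x set)"
begin

lemma b_nonneg [simp]: "b x y \<ge> 0" and b_sym: "b x y = b y x" and b_self [simp]: "b x x = 0"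
  and b_summable [simp]: "b x summable_on UNIV" and c_nonneg [simp]: "c x \<ge> 0"
  using graph by (auto simp: weighted_graph_def)

lemma b_transpose: "(\<lambda>(x, y). b y x) = (\<lambda>(x, y). b x y)"
  by (intro ext) (auto intro: b_sym)

lemma Dtilde_linfty: "Dtilde b c \<subseteq> linfty"
  using compactifiable by (simp add: canonically_compactifiable_def)

text \<open>The one comparison behind the closure properties of \<open>Dtilde\<close>: both sums in
  the energy are dominated term by term, so each operation below reduces to an inequality between
  complex numbers.\<close>

lemma Dtilde_dominated:
  assumes "f \<in> Dtilde b c" "g \<in> Dtilde b c"
    and "\<And>x y. (cmod (h x - h y))\<^sup>2 \<le> C * ((cmod (f x - f y))\<^sup>2 + (cmod (g x - g y))\<^sup>2)"
    and "\<And>x. (cmod (h x))\<^sup>2 \<le> C * ((cmod (f x))\<^sup>2 + (cmod (g x))\<^sup>2)"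
  shows "h \<in> Dtilde b c"
  unfolding Dtilde_def
proof (intro CollectI conjI)
  have "(\<lambda>p. C * ((case p of (x, y) \<Rightarrow> b x y * (cmod (f x - f y))\<^sup>2)
      + (case p of (x, y) \<Rightarrow> b x y * (cmod (g x - g y))\<^sup>2))) summable_on UNIV"
    using assms(1,2) unfolding Dtilde_def
    by (intro summable_on_cmult_right summable_on_add) auto
  then show "(\<lambda>(x, y). b x y * (cmod (h x - h y))\<^sup>2) summable_on UNIV"
  proof (rule summable_on_comparison_test, goal_cases)
    case (1 p)
    show ?case
      using mult_left_mono[OF assms(3)[of "fst p" "snd p"], of "b (fst p) (snd p)"]
      by (simp add: case_prod_unfold algebra_simps)
  qed auto
  have "(\<lambda>x. C * (c x * (cmod (f x))\<^sup>2 + c x * (cmod (g x))\<^sup>2)) summable_on UNIV"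
    using assms(1,2) unfolding Dtilde_def
    by (intro summable_on_cmult_right summable_on_add) auto
  then show "(\<lambda>x. c x * (cmod (h x))\<^sup>2) summable_on UNIV"
  proof (rule summable_on_comparison_test, goal_cases)
    case (1 x)
    show ?case
      using mult_left_mono[OF assms(4)[of x], of "c x"] by (simp add: algebra_simps)
  qed auto
qed

lemma Dtilde_add:
  assumes "f \<in> Dtilde b c" "g \<in> Dtilde b c"
  shows "(\<lambda>x. f x + g x) \<in> Dtilde b c"
proof (rule Dtilde_dominated[OF assms, where C = 2])
  have *: "(cmod (z + w))\<^sup>2 \<le> 2 * ((cmod z)\<^sup>2 + (cmod w)\<^sup>2)" for z w
  proof -
    have "(cmod (z + w))\<^sup>2 \<le> (cmod z + cmod w)\<^sup>2"
      by (intro power_mono norm_triangle_ineq) simp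
    also have "\<dots> \<le> 2 * ((cmod z)\<^sup>2 + (cmod w)\<^sup>2)"
      using sum_squares_ge_zero[of "cmod z - cmod w" 0]
      by (simp add: power2_eq_square algebra_simps)
    finally show ?thesis .
  qed
  show "(cmod (f x + g x))\<^sup>2 \<le> 2 * ((cmod (f x))\<^sup>2 + (cmod (g x))\<^sup>2)" for x
    by (rule *)
  show "(cmod (f x + g x - (f y + g y)))\<^sup>2 \<le> 2 * ((cmod (f x - f y))\<^sup>2 + (cmod (g x - g y))\<^sup>2)" for x y
    using *[of "f x - f y" "g x - g y"] by (simp add: algebra_simps)
qed

lemma Dtilde_scale:
  assumes "f \<in> Dtilde b c"
  shows "(\<lambda>x. a * f x) \<in> Dtilde b c"
proof (rule Dtilde_dominated[OF assms assms, where C = "(cmod a)\<^sup>2"])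
  show "(cmod (a * f x))\<^sup>2 \<le> (cmod a)\<^sup>2 * ((cmod (f x))\<^sup>2 + (cmod (f x))\<^sup>2)" for x
    by (simp add: norm_mult power_mult_distrib algebra_simps)
  show "(cmod (a * f x - a * f y))\<^sup>2 \<le> (cmod a)\<^sup>2 * ((cmod (f x - f y))\<^sup>2 + (cmod (f x - f y))\<^sup>2)" for x y
  proof -
    have "cmod (a * f x - a * f y) = cmod a * cmod (f x - f y)"
      by (metis norm_mult right_diff_distrib)
    then show ?thesis by (simp add: power_mult_distrib mult_left_mono)
  qed
qed

lemma Dtilde_diff:
  assumes "f \<in> Dtilde b c" "g \<in> Dtilde b c"
  shows "(\<lambda>x. f x - g x) \<in> Dtilde b c"
  using Dtilde_add[OF assms(1) Dtilde_scale[OF assms(2), of "-1"]] by simp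

lemma Dtilde_cnj:
  assumes "f \<in> Dtilde b c"
  shows "(\<lambda>x. cnj (f x)) \<in> Dtilde b c"
proof (rule Dtilde_dominated[OF assms assms, where C = 1])
  show "(cmod (cnj (f x) - cnj (f y)))\<^sup>2 \<le> 1 * ((cmod (f x - f y))\<^sup>2 + (cmod (f x - f y))\<^sup>2)" for x y
  proof -
    have "cmod (cnj (f x) - cnj (f y)) = cmod (f x - f y)"
      by (metis complex_cnj_diff complex_mod_cnj)
    then show ?thesis by simp
  qed
qed simp

text \<open>The product rule for differences has the bounded coefficients g x and f y. Their
  boundedness is exactly what canonical compactifiability supplies.\<close>

lemma Dtilde_mult:
  assumes f: "f \<in> Dtilde b c" and g: "g \<in> Dtilde b c"
  shows "(\<lambda>x. f x * g x) \<in> Dtilde b c"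
proof -
  obtain M N where MN: "\<And>x. cmod (f x) \<le> M" "\<And>x. cmod (g x) \<le> N"
    using f g Dtilde_linfty linfty_iff by (metis subsetD)
  define K where "K = max M N"
  have K: "cmod (f x) \<le> K" "cmod (g x) \<le> K" for x
    unfolding K_def using MN by (auto intro: max.coboundedI1 max.coboundedI2)
  have "K \<ge> 0" using K norm_ge_zero order_trans by blast
  have est: "(cmod (z * w + z' * w'))\<^sup>2 \<le> 2 * K\<^sup>2 * ((cmod w)\<^sup>2 + (cmod w')\<^sup>2)"
    if "cmod z \<le> K" "cmod z' \<le> K" for z w z' w'
  proof -
    have "cmod (z * w + z' * w') \<le> K * cmod w + K * cmod w'"
      using that by (intro norm_triangle_le add_mono) (auto simp: norm_mult intro: mult_right_mono)
    then have "(cmod (z * w + z' * w'))\<^sup>2 \<le> (K * cmod w + K * cmod w')\<^sup>2"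
      by (intro power_mono) auto
    also have "\<dots> \<le> 2 * K\<^sup>2 * ((cmod w)\<^sup>2 + (cmod w')\<^sup>2)"
      using sum_squares_ge_zero[of "K * cmod w - K * cmod w'" 0]
      by (simp add: power2_eq_square algebra_simps)
    finally show ?thesis .
  qed
  show ?thesis
  proof (rule Dtilde_dominated[OF f g, where C = "2 * K\<^sup>2"])
    show "(cmod (f x * g x))\<^sup>2 \<le> 2 * K\<^sup>2 * ((cmod (f x))\<^sup>2 + (cmod (g x))\<^sup>2)" for x
    proof -
      \<comment> \<open>The dummy summand brings the product into the two-term shape of
        \<open>est\<close>.\<close>
      have "(cmod (0 * f x + f x * g x))\<^sup>2 \<le> 2 * K\<^sup>2 * ((cmod (f x))\<^sup>2 + (cmod (g x))\<^sup>2)"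
        by (rule est) (use K \<open>K \<ge> 0\<close> in auto)
      then show ?thesis by simp
    qed
    show "(cmod (f x * g x - f y * g y))\<^sup>2 \<le> 2 * K\<^sup>2 * ((cmod (f x - f y))\<^sup>2 + (cmod (g x - g y))\<^sup>2)" for x y
    proof -
      have "f x * g x - f y * g y = g x * (f x - f y) + f y * (g x - g y)"
        by (simp add: algebra_simps)
      then show ?thesis using est[OF K(2)[of x] K(1)[of y]] by metis
    qed
  qed
qed

lemma Dtilde_const:
  assumes "c summable_on UNIV"
  shows "(\<lambda>_. a) \<in> Dtilde b c"
  using summable_on_cmult_left[OF assms, of "(cmod a)\<^sup>2"] by (simp add: Dtilde_def case_prod_unfold)

text \<open>These indicators serve twice: as directions for the first variation of the energy, and
  as the elements of the algebra that tell boundary characters from evaluations.\<close>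

definition point :: "'x \<Rightarrow> 'x \<Rightarrow> complex" where
  "point x y = (if y = x then 1 else 0)"

text \<open>Only edges at x carry energy. They form a row and a column of b, each summable because b
  is summable at x and symmetric.\<close>

lemma Dtilde_point: "point x \<in> Dtilde b c"
  unfolding Dtilde_def
proof (intro CollectI conjI)
  have star: "(\<lambda>(u, v). b u v) summable_on ({x} \<times> UNIV)"
  proof -
    have "b x summable_on UNIV" by simp
    moreover have "b x summable_on UNIV \<longleftrightarrow> (\<lambda>(u, v). b u v) summable_on ({x} \<times> UNIV)"
      by (rule summable_on_reindex_bij_witness[where i = snd and j = "Pair x"]) auto
    ultimately show ?thesis by simp
  qed
  then have "(\<lambda>(u, v). b u v) summable_on (UNIV \<times> {x})"
    by (subst summable_on_swap) (simp add: b_transpose)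
  with star have "(\<lambda>(u, v). b u v) summable_on ({x} \<times> UNIV \<union> UNIV \<times> {x})"
    by (rule summable_on_union)
  also have "?this \<longleftrightarrow> (\<lambda>p. case p of (u, v) \<Rightarrow> if u = x \<or> v = x then b u v else 0) summable_on UNIV"
    by (rule summable_on_cong_neutral) (auto split: if_splits)
  finally show "(\<lambda>(u, v). b u v * (cmod (point x u - point x v))\<^sup>2) summable_on UNIV"
    by (rule summable_on_comparison_test) (auto simp: point_def)
  have "(\<lambda>u. c u * (cmod (point x u))\<^sup>2) summable_on {x}" by simp
  also have "?this \<longleftrightarrow> (\<lambda>u. c u * (cmod (point x u))\<^sup>2) summable_on UNIV"
    by (rule summable_on_cong_neutral) (auto simp: point_def)
  finally show "(\<lambda>u. c u * (cmod (point x u))\<^sup>2) summable_on UNIV" .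
qed

lemma finite_support_induct [consumes 1, case_names zero add]:
  assumes "finite {x. f x \<noteq> 0}"
    and "P (\<lambda>_. 0)"
    and "\<And>f x a. finite {x. f x \<noteq> 0} \<Longrightarrow> P f \<Longrightarrow> P (\<lambda>y. f y + a * point x y)"
  shows "P f"
proof -
  have "P g" if "finite F" "{x. g x \<noteq> 0} \<subseteq> F" for F g
    using that
  proof (induction F arbitrary: g rule: finite_induct)
    case empty
    then have "g = (\<lambda>_. 0)" by auto
    then show ?case using assms(2) by simp
  next
    case (insert x F)
    define h where "h = g(x := 0)"
    have sub: "{y. h y \<noteq> 0} \<subseteq> F" using insert.prems by (auto simp: h_def)
    have "P h" by (rule insert.IH[OF sub])
    then have "P (\<lambda>y. h y + g x * point x y)"
      using sub insert.hyps finite_subset by (intro assms(3)) blast+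
    also have "(\<lambda>y. h y + g x * point x y) = g" by (auto simp: h_def point_def)
    finally show ?case .
  qed
  then show ?thesis using assms(1) by blast
qed

lemma Dtilde_zero: "(\<lambda>_. 0) \<in> Dtilde b c"
  by (simp add: Dtilde_def case_prod_unfold)

lemma Dtilde_finite_support: "finite {x. f x \<noteq> 0} \<Longrightarrow> f \<in> Dtilde b c"
proof (induction rule: finite_support_induct)
  case (add f x a)
  show ?case by (rule Dtilde_add[OF add(2) Dtilde_scale[OF Dtilde_point]])
qed (rule Dtilde_zero)

section \<open>The algebra of uniform limits and its unitisation\<close>

lemma cstar_Aalg: "cstar_subalgebra (Aalg b c)"
  unfolding Aalg_def
  by (rule cstar_subalgebra_sup_closure)
     (fact Dtilde_linfty Dtilde_zero Dtilde_add Dtilde_mult Dtilde_scale Dtilde_cnj)+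

lemma Dtilde_subset_Aalg: "Dtilde b c \<subseteq> Aalg b c"
  unfolding Aalg_def by (rule subset_sup_closure[OF Dtilde_linfty])

lemma Aalg_approx:
  assumes "f \<in> Aalg b c" "e > 0"
  obtains g where "g \<in> Dtilde b c" "\<And>x. cmod (f x - g x) \<le> e"
  using assms sup_closureD unfolding Aalg_def by metis

lemma Aalg_linfty: "Aalg b c \<subseteq> linfty"
  using cstar_Aalg by (simp add: cstar_subalgebra_def)

lemma Aalg_zero: "(\<lambda>_. 0) \<in> Aalg b c"
  and Aalg_add: "f \<in> Aalg b c \<Longrightarrow> g \<in> Aalg b c \<Longrightarrow> (\<lambda>x. f x + g x) \<in> Aalg b c"
  and Aalg_mult: "f \<in> Aalg b c \<Longrightarrow> g \<in> Aalg b c \<Longrightarrow> (\<lambda>x. f x * g x) \<in> Aalg b c"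
  and Aalg_scale: "f \<in> Aalg b c \<Longrightarrow> (\<lambda>x. a * f x) \<in> Aalg b c"
  and Aalg_cnj: "f \<in> Aalg b c \<Longrightarrow> (\<lambda>x. cnj (f x)) \<in> Aalg b c"
  and Aalg_closed: "sup_closure (Aalg b c) \<subseteq> Aalg b c"
  using cstar_Aalg by (auto simp: cstar_subalgebra_def)

lemma Aalg_diff:
  assumes "f \<in> Aalg b c" "g \<in> Aalg b c"
  shows "(\<lambda>x. f x - g x) \<in> Aalg b c"
  using Aalg_add[OF assms(1) Aalg_scale[OF assms(2), of "-1"]] by simp

text \<open>Otherwise a function of finite energy close to g would stay away from 0, and its
  summable killing term would force c to be summable. This is the quantitative form of 1 not lying
  in \<open>Aalg\<close>; it makes the constant part of g + \<alpha> unique and continuous.\<close>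

lemma Aalg_distance_from_constants:
  assumes "\<not> c summable_on UNIV" "g \<in> Aalg b c" "\<And>x. cmod (g x + \<alpha>) \<le> e"
  shows "cmod \<alpha> \<le> e"
proof (rule ccontr)
  assume neg: "\<not> cmod \<alpha> \<le> e"
  \<comment> \<open>Half of the gap is spent on approximating g; the other half remains as the lower
    bound for f.\<close>
  define d where "d = (cmod \<alpha> - e) / 2"
  have "d > 0" using neg by (simp add: d_def)
  obtain f where f: "f \<in> Dtilde b c" "\<And>x. cmod (g x - f x) \<le> d"
    using Aalg_approx[OF assms(2) \<open>d > 0\<close>] by blast
  have "d \<le> cmod (f x)" for x
  proof -
    have "cmod \<alpha> \<le> cmod (g x + \<alpha>) + cmod (g x - f x) + cmod (f x)"
    proof -
      have "(g x + \<alpha>) - (g x - f x) - f x = \<alpha>" by simp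
      then show ?thesis
        using order_trans[OF norm_triangle_ineq4 add_right_mono[OF norm_triangle_ineq4],
            of "g x + \<alpha>" "g x - f x" "f x"] by (simp only:)
    qed
    then show ?thesis using assms(3)[of x] f(2)[of x] by (simp add: d_def)
  qed
  then have "c x * d\<^sup>2 \<le> c x * (cmod (f x))\<^sup>2" for x
    using \<open>d > 0\<close> by (intro mult_left_mono power_mono) auto
  moreover have "(\<lambda>x. c x * (cmod (f x))\<^sup>2) summable_on UNIV"
    using f(1) by (simp add: Dtilde_def)
  ultimately have "(\<lambda>x. c x * d\<^sup>2) summable_on UNIV"
    using summable_on_comparison_test[of "\<lambda>x. c x * (cmod (f x))\<^sup>2" UNIV "\<lambda>x. c x * d\<^sup>2"] by simp
  then show False
    using assms(1) \<open>d > 0\<close> by (subst (asm) summable_on_cmult_left') auto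
qed

text \<open>The real content is that adding constants leaves the algebra uniformly closed. If c is
  summable, constants already lie in \<open>Aalg\<close>. If not, the distance lemma makes the
  constant parts of an approximating sequence Cauchy, and subtracting their limit leaves a uniform
  limit of elements of \<open>Aalg\<close>.\<close>

lemma Aplus_eq: "Aplus b c = {f. \<exists>g\<in>Aalg b c. \<exists>\<alpha>. f = (\<lambda>x. g x + \<alpha>)}" (is "_ = ?S")
  and cstar_Aplus: "cstar_subalgebra (Aplus b c)"
proof -
  have sub: "?S \<subseteq> linfty"
  proof safe
    fix g :: "'x \<Rightarrow> complex" and \<alpha>
    assume "g \<in> Aalg b c"
    then obtain M where M: "\<And>x. cmod (g x) \<le> M" using Aalg_linfty linfty_iff by blast
    have "cmod (g x + \<alpha>) \<le> M + cmod \<alpha>" for x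
      using M[of x] norm_triangle_ineq[of "g x" \<alpha>] by linarith
    then show "(\<lambda>x. g x + \<alpha>) \<in> linfty" by (auto simp: linfty_iff)
  qed
  have closed: "sup_closure ?S \<subseteq> ?S"
  proof
    fix f assume f: "f \<in> sup_closure ?S"
    show "f \<in> ?S"
    proof (cases "c summable_on UNIV")
      case True
      then have const: "(\<lambda>_. \<alpha>) \<in> Aalg b c" for \<alpha>
        using Dtilde_const Dtilde_subset_Aalg by blast
      have "?S \<subseteq> Aalg b c" using Aalg_add[OF _ const] by blast
      then have "f \<in> sup_closure (Aalg b c)"
        using f sup_closure_mono by blast
      then have "f \<in> Aalg b c" using Aalg_closed by blast
      then show ?thesis by (intro CollectI bexI[of _ f] exI[of _ 0]) auto
    next
      case False
      have "\<exists>g \<alpha>. g \<in> Aalg b c \<and> (\<forall>x. cmod (f x - (g x + \<alpha>)) \<le> inverse (real (Suc n)))" for n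
      proof -
        obtain h where h: "h \<in> ?S" "\<And>x. cmod (f x - h x) \<le> inverse (real (Suc n))"
          using sup_closureD[OF f, of "inverse (real (Suc n))"] by auto
        then obtain g \<alpha> where "g \<in> Aalg b c" "h = (\<lambda>x. g x + \<alpha>)" by blast
        with h(2) show ?thesis by auto
      qed
      then obtain g \<alpha> where g: "\<And>n. g n \<in> Aalg b c"
        "\<And>n x. cmod (f x - (g n x + \<alpha> n)) \<le> inverse (real (Suc n))" by metis
      have dist: "cmod (\<alpha> n - \<alpha> m) \<le> inverse (real (Suc n)) + inverse (real (Suc m))" for n m
      proof (rule Aalg_distance_from_constants[OF False Aalg_diff[OF g(1)[of n] g(1)[of m]]])
        fix x
        have eq: "g n x - g m x + (\<alpha> n - \<alpha> m) = (f x - (g m x + \<alpha> m)) - (f x - (g n x + \<alpha> n))"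
          by simp
        show "cmod (g n x - g m x + (\<alpha> n - \<alpha> m)) \<le> inverse (real (Suc n)) + inverse (real (Suc m))"
          unfolding eq using g(2)[of x n] g(2)[of x m]
            norm_triangle_ineq4[of "f x - (g m x + \<alpha> m)" "f x - (g n x + \<alpha> n)"] by linarith
      qed
      have lim: "(\<lambda>n. inverse (real (Suc n))) \<longlonglongrightarrow> 0" by (rule LIMSEQ_inverse_real_of_nat)
      have "Cauchy \<alpha>"
      proof (rule metric_CauchyI)
        fix e :: real assume "e > 0"
        then have "\<forall>\<^sub>F n in sequentially. inverse (real (Suc n)) < e/2"
          by (intro order_tendstoD(2)[OF lim]) auto
        then obtain N where N: "\<And>n. n \<ge> N \<Longrightarrow> inverse (real (Suc n)) < e/2"
          by (auto simp: eventually_sequentially)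
        then show "\<exists>M. \<forall>m\<ge>M. \<forall>n\<ge>M. dist (\<alpha> m) (\<alpha> n) < e"
        proof (intro exI allI impI)
          fix m n assume "m \<ge> N" "n \<ge> N"
          then show "dist (\<alpha> m) (\<alpha> n) < e"
            using dist[of m n] N[of m] N[of n] unfolding dist_norm by linarith
        qed
      qed
      then obtain \<beta> where \<beta>: "\<alpha> \<longlonglongrightarrow> \<beta>" by (auto simp: Cauchy_convergent_iff convergent_def)
      have "(\<lambda>x. f x - \<beta>) \<in> sup_closure (Aalg b c)"
      proof (rule sup_closureI[OF Aalg_linfty])
        fix e :: real assume "e > 0"
        have "\<forall>\<^sub>F n in sequentially. inverse (real (Suc n)) < e/2"
          using \<open>e > 0\<close> by (intro order_tendstoD(2)[OF lim]) auto
        moreover have "\<forall>\<^sub>F n in sequentially. dist (\<alpha> n) \<beta> < e/2"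
          using \<beta> \<open>e > 0\<close> by (intro tendstoD) auto
        ultimately have "\<forall>\<^sub>F n in sequentially. inverse (real (Suc n)) < e/2 \<and> dist (\<alpha> n) \<beta> < e/2"
          by eventually_elim simp
        then obtain n where n: "inverse (real (Suc n)) < e/2" "dist (\<alpha> n) \<beta> < e/2"
          using eventually_happens sequentially_bot by blast
        have "cmod (f x - \<beta> - g n x) \<le> e" for x
        proof -
          have eq: "f x - \<beta> - g n x = (f x - (g n x + \<alpha> n)) + (\<alpha> n - \<beta>)" by simp
          show ?thesis
            unfolding eq using n g(2)[of x n] norm_triangle_ineq[of "f x - (g n x + \<alpha> n)" "\<alpha> n - \<beta>"]
            unfolding dist_norm by linarith
        qed
        then show "\<exists>g\<in>Aalg b c. \<forall>x. cmod (f x - \<beta> - g x) \<le> e" using g(1) by blast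
      qed
      then have "(\<lambda>x. f x - \<beta>) \<in> Aalg b c" using Aalg_closed by blast
      then show ?thesis
        by (intro CollectI bexI[of _ "\<lambda>x. f x - \<beta>"] exI[of _ \<beta>]) auto
    qed
  qed
  have SI: "f \<in> ?S" if "g \<in> Aalg b c" "f = (\<lambda>x. g x + \<alpha>)" for f g \<alpha>
    using that by blast
  have cstar: "cstar_subalgebra ?S"
    unfolding cstar_subalgebra_def
  proof (intro conjI ballI allI sub closed)
    show "(\<lambda>_. 0) \<in> ?S" using Aalg_zero by force
    fix f assume "f \<in> ?S"
    then obtain g \<alpha> where g: "g \<in> Aalg b c" "f = (\<lambda>x. g x + \<alpha>)" by blast
    show "(\<lambda>x. a * f x) \<in> ?S" for a
      by (rule SI[OF Aalg_scale[OF g(1), of a], of _ "a * \<alpha>"]) (simp add: g distrib_left)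
    show "(\<lambda>x. cnj (f x)) \<in> ?S"
      by (rule SI[OF Aalg_cnj[OF g(1)], of _ "cnj \<alpha>"]) (simp add: g)
    fix f' assume "f' \<in> ?S"
    then obtain g' \<alpha>' where g': "g' \<in> Aalg b c" "f' = (\<lambda>x. g' x + \<alpha>')" by blast
    show "(\<lambda>x. f x + f' x) \<in> ?S"
      by (rule SI[OF Aalg_add[OF g(1) g'(1)], of _ "\<alpha> + \<alpha>'"]) (simp add: g g' algebra_simps)
    have "(\<lambda>x. g x * g' x + (\<alpha>' * g x + \<alpha> * g' x)) \<in> Aalg b c"
      by (intro Aalg_add Aalg_mult Aalg_scale g(1) g'(1))
    then show "(\<lambda>x. f x * f' x) \<in> ?S"
      by (rule SI[of _ _ "\<alpha> * \<alpha>'"]) (simp add: g g' algebra_simps)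
  qed
  have "Aalg b c \<subseteq> ?S"
  proof
    fix g assume "g \<in> Aalg b c"
    then show "g \<in> ?S" by (intro CollectI bexI[of _ g] exI[of _ 0]) auto
  qed
  moreover have "(\<lambda>_. 1) \<in> ?S" using Aalg_zero by force
  ultimately have le: "Aplus b c \<subseteq> ?S"
    unfolding Aplus_def using cstar by (intro Inter_lower) blast
  have ge: "?S \<subseteq> Aplus b c"
    unfolding Aplus_def
  proof (intro Inter_greatest subsetI)
    fix T f assume "T \<in> {S. cstar_subalgebra S \<and> Aalg b c \<subseteq> S \<and> (\<lambda>_. 1) \<in> S}" and "f \<in> ?S"
    then obtain g \<alpha> where T: "cstar_subalgebra T" "(\<lambda>_. 1) \<in> T" "g \<in> T" "f = (\<lambda>x. g x + \<alpha>)" by blast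
    have "(\<lambda>x. \<alpha> * 1) \<in> T" by (rule cstar_subalgebra_scale[OF T(1,2)])
    then show "f \<in> T" using cstar_subalgebra_add[OF T(1,3)] unfolding T(4) by simp
  qed
  show "Aplus b c = ?S" using le ge by (rule subset_antisym)
  then show "cstar_subalgebra (Aplus b c)" using cstar by (simp only:)
qed

lemma Aplus_linfty: "Aplus b c \<subseteq> linfty"
  and Aplus_add: "f \<in> Aplus b c \<Longrightarrow> g \<in> Aplus b c \<Longrightarrow> (\<lambda>x. f x + g x) \<in> Aplus b c"
  and Aplus_mult: "f \<in> Aplus b c \<Longrightarrow> g \<in> Aplus b c \<Longrightarrow> (\<lambda>x. f x * g x) \<in> Aplus b c"
  and Aplus_scale: "f \<in> Aplus b c \<Longrightarrow> (\<lambda>x. a * f x) \<in> Aplus b c"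
  and Aplus_cnj: "f \<in> Aplus b c \<Longrightarrow> (\<lambda>x. cnj (f x)) \<in> Aplus b c"
  and Aplus_closed: "sup_closure (Aplus b c) \<subseteq> Aplus b c"
  using cstar_Aplus by (auto simp: cstar_subalgebra_def)

lemma Aalg_subset_Aplus: "Aalg b c \<subseteq> Aplus b c"
  unfolding Aplus_def by blast

lemma Aplus_const: "(\<lambda>_. a) \<in> Aplus b c"
  using Aalg_zero unfolding Aplus_eq by force

lemma Aplus_diff:
  assumes "f \<in> Aplus b c" "g \<in> Aplus b c"
  shows "(\<lambda>x. f x - g x) \<in> Aplus b c"
  using Aplus_add[OF assms(1) Aplus_scale[OF assms(2), of "-1"]] by simp

lemma Aplus_point: "point x \<in> Aplus b c"
  using Dtilde_point Dtilde_subset_Aalg Aalg_subset_Aplus by blast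


section \<open>Characters\<close>

context
  fixes \<gamma>
  assumes char: "\<gamma> \<in> characters b c"
begin

lemma char_add: "f \<in> Aplus b c \<Longrightarrow> g \<in> Aplus b c \<Longrightarrow> \<gamma> (\<lambda>x. f x + g x) = \<gamma> f + \<gamma> g"
  and char_mult: "f \<in> Aplus b c \<Longrightarrow> g \<in> Aplus b c \<Longrightarrow> \<gamma> (\<lambda>x. f x * g x) = \<gamma> f * \<gamma> g"
  and char_scale: "f \<in> Aplus b c \<Longrightarrow> \<gamma> (\<lambda>x. a * f x) = a * \<gamma> f"
  and char_extensional: "\<gamma> \<in> extensional (Aplus b c)"
  and char_nonzero: "\<exists>f\<in>Aplus b c. \<gamma> f \<noteq> 0"
  using char by (auto simp: characters_def)

lemma char_one: "\<gamma> (\<lambda>_. 1) = 1"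
proof -
  obtain f where f: "f \<in> Aplus b c" "\<gamma> f \<noteq> 0" using char_nonzero by blast
  then show ?thesis using char_mult[OF f(1) Aplus_const[of 1]] by simp
qed

lemma char_const: "\<gamma> (\<lambda>_. a) = a"
  using char_scale[OF Aplus_const[of 1], of a] char_one by simp

lemma char_diff:
  assumes "f \<in> Aplus b c" "g \<in> Aplus b c"
  shows "\<gamma> (\<lambda>x. f x - g x) = \<gamma> f - \<gamma> g"
  using char_add[OF assms(1) Aplus_scale[OF assms(2), of "-1"]] char_scale[OF assms(2), of "-1"]
  by simp

text \<open>If \<open>\<bar>f\<bar> \<le> s < \<bar>\<gamma> f\<bar>\<close>, the Neumann series inverts \<open>1 - f / \<gamma> f\<close> inside \<open>\<A>\<^sup>+\<close>,
  although this element lies in the kernel of \<open>\<gamma>\<close>.\<close>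

lemma char_bound:
  assumes f: "f \<in> Aplus b c" and s: "\<And>x. cmod (f x) \<le> s"
  shows "cmod (\<gamma> f) \<le> s"
proof (rule ccontr)
  assume less: "\<not> cmod (\<gamma> f) \<le> s"
  have "s \<ge> 0" using s norm_ge_zero order_trans by blast
  then have nz: "\<gamma> f \<noteq> 0" using less by auto
  define h where "h = (\<lambda>x. inverse (\<gamma> f) * f x)"
  define q where "q = s / cmod (\<gamma> f)"
  have q: "0 \<le> q" "q < 1" using less \<open>s \<ge> 0\<close> nz by (auto simp: q_def field_simps)
  have h: "h \<in> Aplus b c" unfolding h_def by (rule Aplus_scale[OF f])
  have \<gamma>h: "\<gamma> h = 1" unfolding h_def using char_scale[OF f] nz by simp
  have hq: "cmod (h x) \<le> q" for x
    using s[of x] divide_right_mono[of "cmod (f x)" s "cmod (\<gamma> f)"]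
    by (simp add: h_def q_def norm_mult norm_inverse divide_inverse mult.commute)
  have ne: "1 - h x \<noteq> 0" for x
    using hq[of x] q by (metis eq_iff_diff_eq_0 norm_one not_le)
  have pow: "(\<lambda>x. h x ^ n) \<in> Aplus b c" for n
  proof (induction n)
    case 0
    then show ?case using Aplus_const[of 1] by simp
  next
    case (Suc n)
    then show ?case using Aplus_mult[OF h Suc] by simp
  qed
  have geom: "(\<lambda>x. \<Sum>k<n. h x ^ k) \<in> Aplus b c" for n
  proof (induction n)
    case 0
    then show ?case using Aplus_const[of 0] by simp
  next
    case (Suc n)
    then show ?case using Aplus_add[OF Suc pow[of n]] by simp
  qed
  have "(\<lambda>x. inverse (1 - h x)) \<in> sup_closure (Aplus b c)"
  proof (rule sup_closureI[OF Aplus_linfty])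
    fix e :: real assume "e > 0"
    then obtain n where n: "q ^ n < e * (1 - q)"
      using real_arch_pow_inv[of "e * (1 - q)" q] q by auto
    have "cmod (inverse (1 - h x) - (\<Sum>k<n. h x ^ k)) \<le> e" for x
    proof -
      have "(1 - h x) * (\<Sum>k<n. h x ^ k) = 1 - h x ^ n"
        by (simp add: sum_gp_strict ne)
      then have "inverse (1 - h x) - (\<Sum>k<n. h x ^ k) = h x ^ n / (1 - h x)"
        using ne[of x] by (simp add: field_simps)
      then have "cmod (inverse (1 - h x) - (\<Sum>k<n. h x ^ k)) = cmod (h x) ^ n / cmod (1 - h x)"
        by (simp add: norm_divide norm_power)
      also have "\<dots> \<le> q ^ n / (1 - q)"
      proof (rule frac_le)
        show "cmod (h x) ^ n \<le> q ^ n" using hq by (intro power_mono) auto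
        show "1 - q \<le> cmod (1 - h x)"
          using hq[of x] norm_triangle_ineq2[of 1 "h x"] by simp
      qed (use q in auto)
      also have "\<dots> \<le> e" using n q by (simp add: field_simps)
      finally show ?thesis .
    qed
    then show "\<exists>g\<in>Aplus b c. \<forall>x. cmod (inverse (1 - h x) - g x) \<le> e"
      by (intro bexI[OF _ geom]) auto
  qed
  then have inv: "(\<lambda>x. inverse (1 - h x)) \<in> Aplus b c" using Aplus_closed by blast
  have "\<gamma> (\<lambda>x. (1 - h x) * inverse (1 - h x)) = \<gamma> (\<lambda>x. 1 - h x) * \<gamma> (\<lambda>x. inverse (1 - h x))"
    by (rule char_mult[OF Aplus_diff[OF Aplus_const h] inv])
  also have "\<gamma> (\<lambda>x. 1 - h x) = 0"
    using char_diff[OF Aplus_const[of 1] h] char_one \<gamma>h by simp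
  finally show False using ne char_one by simp
qed

text \<open>\<open>\<bar>\<gamma> (f + i t)\<bar>\<^sup>2 \<le> M\<^sup>2 + t\<^sup>2\<close> for all real \<open>t\<close> excludes a nonzero imaginary part of \<open>\<gamma> f\<close>.\<close>

lemma char_real:
  assumes f: "f \<in> Aplus b c" and real: "\<And>x. Im (f x) = 0"
  shows "Im (\<gamma> f) = 0"
proof (rule ccontr)
  assume nz: "Im (\<gamma> f) \<noteq> 0"
  define \<beta> where "\<beta> = Im (\<gamma> f)"
  obtain M where M: "\<And>x. cmod (f x) \<le> M" using f Aplus_linfty linfty_iff by blast
  \<comment> \<open>Chosen so that the cross term \<open>2 * \<beta> * t\<close> of the square
    exceeds \<open>M\<^sup>2\<close> by 1.\<close>
  define t where "t = (M\<^sup>2 + 1) / (2 * \<beta>)"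
  have "cmod (f x + \<i> * of_real t) \<le> sqrt (M\<^sup>2 + t\<^sup>2)" for x
  proof -
    have "\<bar>Re (f x)\<bar> \<le> M" using M[of x] abs_Re_le_cmod order_trans by blast
    then have "(Re (f x))\<^sup>2 \<le> M\<^sup>2" by (metis abs_ge_zero power2_abs power_mono)
    then show ?thesis using real[of x] by (simp add: cmod_def)
  qed
  moreover have "(\<lambda>x. f x + \<i> * of_real t) \<in> Aplus b c" by (rule Aplus_add[OF f Aplus_const])
  ultimately have "cmod (\<gamma> (\<lambda>x. f x + \<i> * of_real t)) \<le> sqrt (M\<^sup>2 + t\<^sup>2)"
    by (intro char_bound) auto
  then have "cmod (\<gamma> f + \<i> * of_real t) \<le> sqrt (M\<^sup>2 + t\<^sup>2)"
    using char_add[OF f Aplus_const] char_const by simp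
  then have "(Re (\<gamma> f))\<^sup>2 + (\<beta> + t)\<^sup>2 \<le> M\<^sup>2 + t\<^sup>2"
    by (simp add: cmod_def \<beta>_def)
  then have "\<beta>\<^sup>2 + 2 * \<beta> * t \<le> M\<^sup>2"
    using zero_le_power2[of "Re (\<gamma> f)"] unfolding power2_sum by linarith
  moreover have "2 * \<beta> * t = M\<^sup>2 + 1" using nz by (simp add: t_def \<beta>_def)
  ultimately show False using zero_le_power2[of \<beta>] by linarith
qed

text \<open>Both f + cnj f and i (f - cnj f) are real valued, so \<open>char_real\<close> yields one
  real equation from each. This is what puts real and imaginary parts of boundary values back into
  the algebra.\<close>

lemma char_cnj:
  assumes f: "f \<in> Aplus b c"
  shows "\<gamma> (\<lambda>x. cnj (f x)) = cnj (\<gamma> f)"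
proof -
  have f': "(\<lambda>x. cnj (f x)) \<in> Aplus b c" by (rule Aplus_cnj[OF f])
  have "Im (\<gamma> (\<lambda>x. f x + cnj (f x))) = 0"
    by (rule char_real[OF Aplus_add[OF f f']]) simp
  then have 1: "Im (\<gamma> f) + Im (\<gamma> (\<lambda>x. cnj (f x))) = 0"
    using char_add[OF f f'] by simp
  have "Im (\<gamma> (\<lambda>x. \<i> * (f x - cnj (f x)))) = 0"
    by (rule char_real[OF Aplus_scale[OF Aplus_diff[OF f f']]]) simp
  then have 2: "Re (\<gamma> f) - Re (\<gamma> (\<lambda>x. cnj (f x))) = 0"
    using char_scale[OF Aplus_diff[OF f f'], of \<i>] char_diff[OF f f'] by simp
  show ?thesis using 1 2 by (simp add: complex_eq_iff)
qed

text \<open>Since f times \<open>point x\<close> equals the scalar f x times \<open>point x\<close>,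
  multiplicativity allows cancelling \<gamma> (point x). Off \<open>Aplus\<close> both functionals
  take the default value of extensional functions.\<close>

lemma char_point:
  assumes "\<gamma> (point x) \<noteq> 0"
  shows "\<gamma> = delta_char b c x"
proof
  fix f
  show "\<gamma> f = delta_char b c x f"
  proof (cases "f \<in> Aplus b c")
    case True
    have "(\<lambda>y. f y * point x y) = (\<lambda>y. f x * point x y)" by (auto simp: point_def)
    then have "\<gamma> f * \<gamma> (point x) = f x * \<gamma> (point x)"
      using char_mult[OF True Aplus_point] char_scale[OF Aplus_point] by metis
    then show ?thesis using assms True by (simp add: delta_char_def)
  next
    case False
    then show ?thesis using char_extensional by (simp add: delta_char_def extensional_def)
  qed
qed

end

section \<open>The compact space of characters and its boundary\<close>

lemma delta_char_in_characters: "delta_char b c x \<in> characters b c"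
  unfolding characters_def delta_char_def
  using Aplus_add Aplus_mult Aplus_scale Aplus_const[of 1] by force

text \<open>Replaces removal of the evaluations by vanishing of coordinates, which is a closed
  condition; in particular every evaluation is an isolated character.\<close>

lemma boundary_iff: "\<gamma> \<in> boundary b c \<longleftrightarrow> \<gamma> \<in> characters b c \<and> (\<forall>x. \<gamma> (point x) = 0)"
proof -
  have "delta_char b c x (point x) = 1" for x
    using Aplus_point[of x] by (simp add: delta_char_def point_def)
  then have "\<gamma> \<noteq> delta_char b c x" if "\<gamma> (point x) = 0" for x
    using that by force
  then show ?thesis
    unfolding boundary_def using char_point by blast
qed

lemma boundary_char: "\<gamma> \<in> boundary b c \<Longrightarrow> \<gamma> \<in> characters b c"
  by (simp add: boundary_iff)

lemma boundary_finite_support: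
  assumes "finite {x. f x \<noteq> 0}" and \<gamma>: "\<gamma> \<in> boundary b c"
  shows "\<gamma> f = 0"
  using assms(1)
proof (induction rule: finite_support_induct)
  case zero
  then show ?case using char_const[OF boundary_char[OF \<gamma>]] by simp
next
  case (add f x a)
  have "f \<in> Aplus b c"
    using Dtilde_finite_support[OF add(1)] Dtilde_subset_Aalg Aalg_subset_Aplus by blast
  then show ?case
    using char_add[OF boundary_char[OF \<gamma>] _ Aplus_scale[OF Aplus_point]]
      char_scale[OF boundary_char[OF \<gamma>] Aplus_point] add.IH \<gamma> by (simp add: boundary_iff)
qed

text \<open>Banach--Alaoglu by hand: \<open>char_bound\<close> places the characters in a product of
  closed discs, compact by Tychonoff, and the algebraic laws are closed conditions on
  coordinates.\<close>

lemma compact_characters: "compact (characters b c)"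
proof -
  define M where "M f = (SUP x. cmod (f x))" for f :: "'x \<Rightarrow> complex"
  \<comment> \<open>The singleton factors encode extensionality outside
    \<open>Aplus\<close>.\<close>
  define P where "P = PiE UNIV (\<lambda>f. if f \<in> Aplus b c then cball (0::complex) (M f) else {undefined})"
  have "compactin (product_topology (\<lambda>_. euclidean) UNIV) P"
    unfolding P_def by (subst compactin_PiE) auto
  then have compP: "compact P" by (simp add: euclidean_product_topology)
  \<comment> \<open>Being nonzero is not a closed condition; for multiplicative functionals it is
    expressed by the value 1 at the unit.\<close>
  define C where "C = {\<gamma>. (\<forall>f\<in>Aplus b c. \<forall>g\<in>Aplus b c. \<gamma> (\<lambda>x. f x + g x) = \<gamma> f + \<gamma> g \<and>
                                     \<gamma> (\<lambda>x. f x * g x) = \<gamma> f * \<gamma> g) \<and>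
     (\<forall>f\<in>Aplus b c. \<forall>a::complex. \<gamma> (\<lambda>x. a * f x) = a * \<gamma> f) \<and> \<gamma> (\<lambda>_. 1) = (1::complex)}"
  have "closed C"
    unfolding C_def Ball_def
    by (intro closed_Collect_conj closed_Collect_all closed_Collect_imp closed_Collect_eq
        open_Collect_const continuous_intros) auto
  have "characters b c = P \<inter> C"
  proof (intro equalityI subsetI)
    fix \<gamma> assume \<gamma>: "\<gamma> \<in> characters b c"
    have "\<gamma> f \<in> cball 0 (M f)" if f: "f \<in> Aplus b c" for f
    proof -
      have "f \<in> linfty" using f Aplus_linfty by blast
      then have "bdd_above (range (\<lambda>x. cmod (f x)))"
        by (auto simp: linfty_iff bdd_above_def)
      then have "cmod (f x) \<le> M f" for x
        unfolding M_def by (intro cSUP_upper) auto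
      then show ?thesis using char_bound[OF \<gamma> f] by simp
    qed
    then have "\<gamma> \<in> P"
      using char_extensional[OF \<gamma>] by (auto simp: P_def PiE_iff extensional_def)
    moreover have "\<gamma> \<in> C"
      unfolding C_def using \<gamma> char_one[OF \<gamma>] by (simp add: characters_def)
    ultimately show "\<gamma> \<in> P \<inter> C" by blast
  next
    fix \<gamma> assume \<gamma>: "\<gamma> \<in> P \<inter> C"
    then have "\<gamma> f = undefined" if "f \<notin> Aplus b c" for f
      using that by (auto simp: P_def PiE_iff dest!: spec[of _ f])
    then have "\<gamma> \<in> extensional (Aplus b c)" by (simp add: extensional_def)
    moreover have "\<exists>f\<in>Aplus b c. \<gamma> f \<noteq> 0"
      using \<gamma> Aplus_const[of 1] by (intro bexI[of _ "\<lambda>_. 1"]) (auto simp: C_def)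
    ultimately show "\<gamma> \<in> characters b c"
      using \<gamma> unfolding characters_def C_def by blast
  qed
  then show ?thesis using compP \<open>closed C\<close> by (simp add: compact_Int_closed)
qed

lemma compact_boundary: "compact (boundary b c)"
proof -
  have "closed {\<gamma> :: ('x \<Rightarrow> complex) \<Rightarrow> complex. \<forall>x. \<gamma> (point x) = 0}"
    by (intro closed_Collect_all closed_Collect_eq continuous_intros continuous_on_product_coordinates)
  moreover have "boundary b c = characters b c \<inter> {\<gamma>. \<forall>x. \<gamma> (point x) = 0}"
    by (auto simp: boundary_iff)
  ultimately show ?thesis using compact_characters by (simp add: compact_Int_closed)
qed

text \<open>The characters with \<bar>\<gamma> f\<bar> \<ge> t form a compact set disjoint from the
  boundary. It is covered by the open sets where \<gamma> (point x) does not vanish, each containing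
  a single character, so a finite subcover leaves only finitely many vertices.\<close>

lemma finite_superlevel:
  assumes f: "f \<in> Aplus b c" and bd: "\<And>\<gamma>. \<gamma> \<in> boundary b c \<Longrightarrow> cmod (\<gamma> f) \<le> s" and "s < t"
  shows "finite {x. cmod (f x) \<ge> t}"
proof -
  define K where "K = characters b c \<inter> {\<gamma>. cmod (\<gamma> f) \<ge> t}"
  have "closed {\<gamma> :: ('x \<Rightarrow> complex) \<Rightarrow> complex. cmod (\<gamma> f) \<ge> t}"
    by (intro closed_Collect_le continuous_intros continuous_on_product_coordinates)
  then have "compact K" unfolding K_def using compact_characters by (rule compact_Int_closed[rotated])
  define U where "U x = {\<gamma> :: ('x \<Rightarrow> complex) \<Rightarrow> complex. \<gamma> (point x) \<noteq> 0}" for x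
  have "open (U x)" for x
    unfolding U_def by (intro open_Collect_neq continuous_intros continuous_on_product_coordinates)
  moreover have "K \<subseteq> (\<Union>x. U x)"
  proof
    fix \<gamma> assume "\<gamma> \<in> K"
    then have "\<gamma> \<in> characters b c" "\<gamma> \<notin> boundary b c"
      using bd \<open>s < t\<close> by (force simp: K_def)+
    then show "\<gamma> \<in> (\<Union>x. U x)" by (auto simp: boundary_iff U_def)
  qed
  ultimately obtain F where F: "finite F" "K \<subseteq> (\<Union>x\<in>F. U x)"
    using compactE_image[OF \<open>compact K\<close>, of UNIV U] by auto
  have "{x. cmod (f x) \<ge> t} \<subseteq> F"
  proof clarify
    fix x assume "t \<le> cmod (f x)"
    then have "delta_char b c x \<in> K"
      using f delta_char_in_characters by (simp add: K_def delta_char_def)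
    then obtain y where "y \<in> F" "delta_char b c x (point y) \<noteq> 0"
      using F(2) by (auto simp: U_def)
    then show "x \<in> F" using Aplus_point[of y] by (auto simp: delta_char_def point_def split: if_splits)
  qed
  then show ?thesis using F(1) finite_subset by blast
qed

text \<open>The definite description is legitimate because two decompositions of one function differ
  by a constant in \<open>Aalg\<close>, and the distance lemma with bound 0 makes that constant
  vanish.\<close>

lemma gamma_infty_eq:
  assumes "\<not> c summable_on UNIV" "g \<in> Aalg b c"
  shows "gamma_infty b c (\<lambda>x. g x + \<alpha>) = \<alpha>"
proof -
  have "(THE \<beta>. \<exists>h\<in>Aalg b c. (\<lambda>x. g x + \<alpha>) = (\<lambda>x. h x + \<beta>)) = \<alpha>"
  proof (rule the_equality)
    show "\<exists>h\<in>Aalg b c. (\<lambda>x. g x + \<alpha>) = (\<lambda>x. h x + \<alpha>)" using assms by blast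
    fix \<beta> assume "\<exists>h\<in>Aalg b c. (\<lambda>x. g x + \<alpha>) = (\<lambda>x. h x + \<beta>)"
    then obtain h where h: "h \<in> Aalg b c" "\<And>x. g x + \<alpha> = h x + \<beta>" by metis
    have "cmod (g x - h x + (\<alpha> - \<beta>)) \<le> 0" for x using h(2)[of x] by (simp add: algebra_simps)
    then have "cmod (\<alpha> - \<beta>) \<le> 0"
      by (rule Aalg_distance_from_constants[OF assms(1) Aalg_diff[OF assms(2) h(1)]])
    then show "\<beta> = \<alpha>" by simp
  qed
  moreover have "(\<lambda>x. g x + \<alpha>) \<in> Aplus b c" using assms(2) by (auto simp: Aplus_eq)
  ultimately show ?thesis by (simp add: gamma_infty_def)
qed

text \<open>Allows estimates valid on the boundary to be evaluated at this character. It annihilates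
  \<open>Aalg\<close>, hence every \<open>point x\<close>; the split of a product below isolates its
  constant part.\<close>

lemma gamma_infty_boundary:
  assumes "\<not> c summable_on UNIV"
  shows "gamma_infty b c \<in> boundary b c"
proof -
  note eq = gamma_infty_eq[OF assms]
  have zero: "gamma_infty b c g = 0" if "g \<in> Aalg b c" for g
    using eq[OF that, of 0] by simp
  have "gamma_infty b c \<in> characters b c"
    unfolding characters_def
  proof (intro CollectI conjI ballI allI)
    show "gamma_infty b c \<in> extensional (Aplus b c)" by (simp add: gamma_infty_def)
    show "\<exists>f\<in>Aplus b c. gamma_infty b c f \<noteq> 0"
      using Aplus_const[of 1] eq[OF Aalg_zero, of 1] by (intro bexI[of _ "\<lambda>_. 1"]) auto
    fix f assume "f \<in> Aplus b c"
    then obtain g \<alpha> where g: "g \<in> Aalg b c" "f = (\<lambda>x. g x + \<alpha>)" unfolding Aplus_eq by blast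
    have "gamma_infty b c (\<lambda>x. a * g x + a * \<alpha>) = a * \<alpha>" for a
      by (rule eq[OF Aalg_scale[OF g(1)]])
    then show "gamma_infty b c (\<lambda>x. a * f x) = a * gamma_infty b c f" for a
      unfolding g(2) eq[OF g(1)] by (simp add: distrib_left)
    fix f' assume "f' \<in> Aplus b c"
    then obtain g' \<alpha>' where g': "g' \<in> Aalg b c" "f' = (\<lambda>x. g' x + \<alpha>')" unfolding Aplus_eq by blast
    have "gamma_infty b c (\<lambda>x. (g x + g' x) + (\<alpha> + \<alpha>')) = \<alpha> + \<alpha>'"
      by (rule eq[OF Aalg_add[OF g(1) g'(1)]])
    moreover have "(\<lambda>x. f x + f' x) = (\<lambda>x. (g x + g' x) + (\<alpha> + \<alpha>'))"
      by (simp add: g(2) g'(2) algebra_simps)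
    ultimately show "gamma_infty b c (\<lambda>x. f x + f' x) = gamma_infty b c f + gamma_infty b c f'"
      using eq[OF g(1)] eq[OF g'(1)] by (simp only: g(2) g'(2))
    have "(\<lambda>x. g x * g' x + (\<alpha>' * g x + \<alpha> * g' x)) \<in> Aalg b c"
      by (intro Aalg_add Aalg_mult Aalg_scale g(1) g'(1))
    then have "gamma_infty b c (\<lambda>x. (g x * g' x + (\<alpha>' * g x + \<alpha> * g' x)) + \<alpha> * \<alpha>') = \<alpha> * \<alpha>'"
      by (rule eq)
    moreover have "(\<lambda>x. f x * f' x) = (\<lambda>x. (g x * g' x + (\<alpha>' * g x + \<alpha> * g' x)) + \<alpha> * \<alpha>')"
      by (simp add: g(2) g'(2) algebra_simps)
    ultimately show "gamma_infty b c (\<lambda>x. f x * f' x) = gamma_infty b c f * gamma_infty b c f'"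
      using eq[OF g(1)] eq[OF g'(1)] by (simp only: g(2) g'(2))
  qed
  moreover have "gamma_infty b c (point x) = 0" for x
    using zero Dtilde_point Dtilde_subset_Aalg by blast
  ultimately show ?thesis by (simp add: boundary_iff)
qed

section \<open>Density of boundary values\<close>

text \<open>The function type carries pointwise convergence on all functions,
  \<open>weakstar_top\<close> only on \<open>Aplus\<close>. The identity is continuous from the
  former to the latter, so continuity of \<phi> transfers in the direction needed.\<close>

lemma C_boundary_continuous_on:
  assumes "\<phi> \<in> C_boundary b c"
  shows "continuous_on (boundary b c) \<phi>"
proof -
  let ?X = "subtopology euclidean (boundary b c)"
  have "continuous_map ?X (product_topology (\<lambda>_. euclidean) (Aplus b c)) (\<lambda>\<gamma>. \<gamma>)"
    unfolding continuous_map_componentwise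
    by (auto intro: char_extensional boundary_char
          continuous_on_product_then_coordinatewise[OF continuous_on_id] simp: continuous_map_iff_continuous)
  then have "continuous_map ?X (subtopology (weakstar_top b c) (boundary b c)) (\<lambda>\<gamma>. \<gamma>)"
    unfolding weakstar_top_def
    by (auto simp: continuous_map_in_subtopology boundary_char)
  from continuous_map_compose[OF this, of euclidean \<phi>] assms
  have "continuous_map ?X euclidean \<phi>" by (simp add: C_boundary_def o_def)
  then show ?thesis by (simp add: continuous_map_iff_continuous)
qed

text \<open>Stone--Weierstrass is applied to real functions, so R collects the real functions that
  agree on the boundary with a transform from \<open>Aplus\<close>; Re \<phi> and Im \<phi> are
  approximated separately.\<close>

lemma Aplus_dense_in_C_boundary:
  assumes cont: "continuous_on (boundary b c) \<phi>" and "e > 0"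
  shows "\<exists>f\<in>Aplus b c. \<forall>\<gamma>\<in>boundary b c. cmod (\<gamma> f - \<phi> \<gamma>) \<le> e"
proof -
  define R where "R = {r. \<exists>f\<in>Aplus b c. \<forall>\<gamma>\<in>boundary b c. complex_of_real (r \<gamma>) = \<gamma> f}"
  have RI: "r \<in> R" if "f \<in> Aplus b c" "\<And>\<gamma>. \<gamma> \<in> boundary b c \<Longrightarrow> complex_of_real (r \<gamma>) = \<gamma> f" for r f
    using that unfolding R_def by blast
  interpret function_ring_on R "boundary b c"
  proof
    show "compact (boundary b c)" by (rule compact_boundary)
    show "continuous_on (boundary b c) r" if r: "r \<in> R" for r
    proof -
      obtain f where "\<And>\<gamma>. \<gamma> \<in> boundary b c \<Longrightarrow> complex_of_real (r \<gamma>) = \<gamma> f"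
        using r unfolding R_def by blast
      then have eq: "Re (\<gamma> f) = r \<gamma>" if "\<gamma> \<in> boundary b c" for \<gamma>
        using that by (metis Re_complex_of_real)
      have "continuous_on (boundary b c) (\<lambda>\<gamma>. Re (\<gamma> f))"
        by (rule continuous_on_Re[OF continuous_on_product_then_coordinatewise[OF continuous_on_id]])
      then show ?thesis using eq by (rule continuous_on_eq)
    qed
    show "(\<lambda>_. a) \<in> R" for a
      by (rule RI[OF Aplus_const[of "of_real a"]]) (simp add: char_const[OF boundary_char])
    fix r r' assume "r \<in> R" "r' \<in> R"
    then obtain f f' where f: "f \<in> Aplus b c" "\<And>\<gamma>. \<gamma> \<in> boundary b c \<Longrightarrow> complex_of_real (r \<gamma>) = \<gamma> f"
      and f': "f' \<in> Aplus b c" "\<And>\<gamma>. \<gamma> \<in> boundary b c \<Longrightarrow> complex_of_real (r' \<gamma>) = \<gamma> f'"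
      unfolding R_def by blast
    show "(\<lambda>\<gamma>. r \<gamma> + r' \<gamma>) \<in> R"
      by (rule RI[OF Aplus_add[OF f(1) f'(1)]])
        (simp add: f(2) f'(2) char_add[OF boundary_char f(1) f'(1)])
    show "(\<lambda>\<gamma>. r \<gamma> * r' \<gamma>) \<in> R"
      by (rule RI[OF Aplus_mult[OF f(1) f'(1)]])
        (simp add: f(2) f'(2) char_mult[OF boundary_char f(1) f'(1)])
  next
    fix \<gamma> \<gamma>' assume \<gamma>: "\<gamma> \<in> boundary b c" "\<gamma>' \<in> boundary b c" "\<gamma> \<noteq> \<gamma>'"
    then obtain f where f: "f \<in> Aplus b c" "\<gamma> f \<noteq> \<gamma>' f"
      using char_extensional[OF boundary_char] extensionalityI by metis
    have f': "(\<lambda>x. cnj (f x)) \<in> Aplus b c" by (rule Aplus_cnj[OF f(1)])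
    \<comment> \<open>Real and imaginary part of f, written in algebra operations. Characters
      commute with conjugation, so one of them separates the two points.\<close>
    define g where "g = (\<lambda>x. (1/2) * (f x + cnj (f x)))"
    define h where "h = (\<lambda>x. (- \<i>/2) * (f x - cnj (f x)))"
    have gA: "g \<in> Aplus b c" and hA: "h \<in> Aplus b c"
      unfolding g_def h_def using Aplus_scale Aplus_add[OF f(1) f'] Aplus_diff[OF f(1) f'] by blast+
    have g: "\<delta> g = of_real (Re (\<delta> f))" and h: "\<delta> h = of_real (Im (\<delta> f))" if "\<delta> \<in> boundary b c" for \<delta>
    proof -
      note ch = boundary_char[OF that]
      show "\<delta> g = of_real (Re (\<delta> f))"
        unfolding g_def char_scale[OF ch Aplus_add[OF f(1) f']] char_add[OF ch f(1) f'] char_cnj[OF ch f(1)]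
        by (simp add: complex_eq_iff)
      show "\<delta> h = of_real (Im (\<delta> f))"
        unfolding h_def char_scale[OF ch Aplus_diff[OF f(1) f']] char_diff[OF ch f(1) f'] char_cnj[OF ch f(1)]
        by (simp add: complex_eq_iff)
    qed
    have "(\<lambda>\<delta>. Re (\<delta> f)) \<in> R" "(\<lambda>\<delta>. Im (\<delta> f)) \<in> R"
      by (rule RI[OF gA], simp add: g) (rule RI[OF hA], simp add: h)
    moreover have "Re (\<gamma> f) \<noteq> Re (\<gamma>' f) \<or> Im (\<gamma> f) \<noteq> Im (\<gamma>' f)"
      using f(2) by (simp add: complex_eq_iff)
    ultimately show "\<exists>r\<in>R. r \<gamma> \<noteq> r \<gamma>'" by (elim disjE) (rule bexI, assumption+)+
  qed
  have "e/2 > 0" using \<open>e > 0\<close> by simp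
  obtain r where r: "r \<in> R" "\<And>\<gamma>. \<gamma> \<in> boundary b c \<Longrightarrow> \<bar>Re (\<phi> \<gamma>) - r \<gamma>\<bar> < e/2"
    using Stone_Weierstrass_basic[OF continuous_on_Re[OF cont] \<open>e/2 > 0\<close>] by blast
  obtain r' where r': "r' \<in> R" "\<And>\<gamma>. \<gamma> \<in> boundary b c \<Longrightarrow> \<bar>Im (\<phi> \<gamma>) - r' \<gamma>\<bar> < e/2"
    using Stone_Weierstrass_basic[OF continuous_on_Im[OF cont] \<open>e/2 > 0\<close>] by blast
  obtain f f' where f: "f \<in> Aplus b c" "\<And>\<gamma>. \<gamma> \<in> boundary b c \<Longrightarrow> complex_of_real (r \<gamma>) = \<gamma> f"
    and f': "f' \<in> Aplus b c" "\<And>\<gamma>. \<gamma> \<in> boundary b c \<Longrightarrow> complex_of_real (r' \<gamma>) = \<gamma> f'"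
    using r(1) r'(1) unfolding R_def by blast
  have if': "(\<lambda>x. \<i> * f' x) \<in> Aplus b c" by (rule Aplus_scale[OF f'(1)])
  have "cmod (\<gamma> (\<lambda>x. f x + \<i> * f' x) - \<phi> \<gamma>) \<le> e" if \<gamma>: "\<gamma> \<in> boundary b c" for \<gamma>
  proof -
    note ch = boundary_char[OF \<gamma>]
    have "\<gamma> (\<lambda>x. f x + \<i> * f' x) = of_real (r \<gamma>) + \<i> * of_real (r' \<gamma>)"
      unfolding char_add[OF ch f(1) if'] char_scale[OF ch f'(1)] f(2)[OF \<gamma>] f'(2)[OF \<gamma>] ..
    then have "cmod (\<gamma> (\<lambda>x. f x + \<i> * f' x) - \<phi> \<gamma>) \<le> \<bar>r \<gamma> - Re (\<phi> \<gamma>)\<bar> + \<bar>r' \<gamma> - Im (\<phi> \<gamma>)\<bar>"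
      using cmod_le[of "\<gamma> (\<lambda>x. f x + \<i> * f' x) - \<phi> \<gamma>"] by simp
    then show ?thesis using r(2)[OF \<gamma>] r'(2)[OF \<gamma>] by linarith
  qed
  then show ?thesis by (intro bexI[OF _ Aplus_add[OF f(1) if']]) auto
qed

text \<open>Three errors of e/3: into \<open>Aplus\<close>, then \<open>Aalg\<close>, then
  \<open>Dtilde\<close>. In the middle step with c not summable, the constant to be dropped is the
  value of f at \<open>gamma_infty\<close>, where \<phi> is 0, so it is no larger than the first
  error.\<close>

lemma Dtilde_dense_in_C0_boundary:
  assumes \<phi>: "\<phi> \<in> C0_boundary b c" and "e > 0"
  shows "\<exists>f\<in>Dtilde b c. \<forall>\<gamma>\<in>boundary b c. cmod (\<gamma> f - \<phi> \<gamma>) \<le> e"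
proof -
  have "\<phi> \<in> C_boundary b c" using \<phi> by (auto simp: C0_boundary_def split: if_splits)
  then obtain f where f: "f \<in> Aplus b c" "\<And>\<gamma>. \<gamma> \<in> boundary b c \<Longrightarrow> cmod (\<gamma> f - \<phi> \<gamma>) \<le> e/3"
    using Aplus_dense_in_C_boundary[OF C_boundary_continuous_on, of \<phi> "e/3"] \<open>e > 0\<close> by auto
  obtain g where g: "g \<in> Aalg b c" "\<And>\<gamma>. \<gamma> \<in> boundary b c \<Longrightarrow> cmod (\<gamma> f - \<gamma> g) \<le> e/3"
  proof -
    obtain g \<alpha> where g: "g \<in> Aalg b c" "f = (\<lambda>x. g x + \<alpha>)" using f(1) unfolding Aplus_eq by blast
    have gp: "g \<in> Aplus b c" using g(1) Aalg_subset_Aplus by blast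
    show thesis
    proof (cases "c summable_on UNIV")
      case True
      then have "(\<lambda>_. \<alpha>) \<in> Aalg b c" using Dtilde_const Dtilde_subset_Aalg by blast
      then have "f \<in> Aalg b c" unfolding g(2) by (rule Aalg_add[OF g(1)])
      then show thesis using \<open>e > 0\<close> by (intro that[of f]) auto
    next
      case False
      have "\<phi> (gamma_infty b c) = 0" using \<phi> False by (simp add: C0_boundary_def)
      moreover have "gamma_infty b c f = \<alpha>" unfolding g(2) by (rule gamma_infty_eq[OF False g(1)])
      ultimately have "cmod \<alpha> \<le> e/3" using f(2)[OF gamma_infty_boundary[OF False]] by simp
      moreover have "\<gamma> f - \<gamma> g = \<alpha>" if "\<gamma> \<in> boundary b c" for \<gamma>
        using char_add[OF boundary_char[OF that] gp Aplus_const] char_const[OF boundary_char[OF that]]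
        by (simp add: g(2))
      ultimately show thesis using g(1) by (intro that[of g]) simp_all
    qed
  qed
  obtain h where h: "h \<in> Dtilde b c" "\<And>x. cmod (g x - h x) \<le> e/3"
    using Aalg_approx[OF g(1), of "e/3"] \<open>e > 0\<close> by auto
  have gp: "g \<in> Aplus b c" and hp: "h \<in> Aplus b c"
    using g(1) h(1) Aalg_subset_Aplus Dtilde_subset_Aalg by blast+
  have "cmod (\<gamma> h - \<phi> \<gamma>) \<le> e" if \<gamma>: "\<gamma> \<in> boundary b c" for \<gamma>
  proof -
    have "cmod (\<gamma> g - \<gamma> h) \<le> e/3"
      using char_bound[OF boundary_char[OF \<gamma>] Aplus_diff[OF gp hp] h(2)]
        char_diff[OF boundary_char[OF \<gamma>] gp hp] by simp
    moreover have "cmod (\<gamma> h - \<phi> \<gamma>) \<le> cmod (\<gamma> f - \<phi> \<gamma>) + cmod (\<gamma> f - \<gamma> g) + cmod (\<gamma> g - \<gamma> h)"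
    proof -
      have eq: "\<gamma> h - \<phi> \<gamma> = (\<gamma> f - \<phi> \<gamma>) - (\<gamma> f - \<gamma> g) - (\<gamma> g - \<gamma> h)" by simp
      show ?thesis
        unfolding eq by (rule order_trans[OF norm_triangle_ineq4 add_right_mono[OF norm_triangle_ineq4]])
    qed
    ultimately show ?thesis using f(2)[OF \<gamma>] g(2)[OF \<gamma>] by linarith
  qed
  then show ?thesis using h(1) by blast
qed

section \<open>Harmonic functions and the maximum principle\<close>

lemma connected_induct:
  assumes "P x" and step: "\<And>y z. P y \<Longrightarrow> b y z > 0 \<Longrightarrow> P z"
  shows "P y"
proof (cases "x = y")
  case False
  then obtain p where p: "p \<noteq> []" "hd p = x" "last p = y"
    "\<And>i. Suc i < length p \<Longrightarrow> b (p ! i) (p ! Suc i) > 0"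
    using connected unfolding graph_connected_def by metis
  have "P (p ! i)" if "i < length p" for i
    using that
  proof (induction i)
    case 0
    then show ?case using p(1,2) assms(1) by (simp add: hd_conv_nth)
  next
    case (Suc i)
    then show ?case using step p(4)[of i] by simp
  qed
  from this[of "length p - 1"] show ?thesis using p(1,3) by (simp add: last_conv_nth)
qed (use assms in simp)

text \<open>The diagonal coefficient of the Laplacian, which is also the energy of
  \<open>point x\<close>.\<close>

definition deg :: "'x \<Rightarrow> real" where
  "deg x = (\<Sum>\<^sub>\<infinity>y. b x y) + c x"

text \<open>For bounded f the series converges absolutely, so the infinite sum in \<open>Lap\<close>
  is a genuine value and not the default 0.\<close>

lemma Lap_has_sum:
  assumes "f \<in> linfty"
  shows "((\<lambda>y. complex_of_real (b x y) * (f x - f y)) has_sum (Lap b c f x - complex_of_real (c x) * f x)) UNIV"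
proof -
  obtain M where M: "\<And>y. cmod (f y) \<le> M" using assms linfty_iff by blast
  have le: "norm (complex_of_real (b x y) * (f x - f y)) \<le> b x y * (2 * M)" for y
  proof -
    have "cmod (f x - f y) \<le> 2 * M"
      using norm_triangle_ineq4[of "f x" "f y"] M[of x] M[of y] by linarith
    then show ?thesis by (simp add: norm_mult mult_left_mono)
  qed
  have "(\<lambda>y. b x y * (2 * M)) summable_on UNIV"
    by (intro summable_on_cmult_left) simp
  then have "(\<lambda>y. norm (complex_of_real (b x y) * (f x - f y))) summable_on UNIV"
    by (rule summable_on_comparison_test) (use le in auto)
  then have "(\<lambda>y. complex_of_real (b x y) * (f x - f y)) summable_on UNIV"
    by (rule abs_summable_summable)
  then show ?thesis by (simp add: Lap_def)
qed

lemma Lap_diff: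
  assumes "f \<in> linfty" "g \<in> linfty"
  shows "Lap b c (\<lambda>x. f x - g x) x = Lap b c f x - Lap b c g x"
proof -
  have "((\<lambda>y. complex_of_real (b x y) * (f x - f y) + - (complex_of_real (b x y) * (g x - g y))) has_sum
      (Lap b c f x - complex_of_real (c x) * f x) + - (Lap b c g x - complex_of_real (c x) * g x)) UNIV"
    by (intro has_sum_add has_sum_uminusI Lap_has_sum assms)
  then have "((\<lambda>y. complex_of_real (b x y) * ((f x - g x) - (f y - g y))) has_sum
      (Lap b c f x - complex_of_real (c x) * f x) + - (Lap b c g x - complex_of_real (c x) * g x)) UNIV"
    by (rule has_sum_cong[THEN iffD1, rotated]) (simp add: algebra_simps)
  then show ?thesis
    unfolding Lap_def[of _ _ "\<lambda>x. f x - g x"] by (simp add: infsumI algebra_simps)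
qed

text \<open>At each fixed vertex the Laplacian is continuous for uniform convergence, even if
  \<open>deg\<close> is unbounded.\<close>

lemma Lap_bound:
  assumes "\<And>y. cmod (f y) \<le> M"
  shows "cmod (Lap b c f x) \<le> 2 * deg x * M"
proof -
  have f: "f \<in> linfty" using assms linfty_iff by blast
  have "M \<ge> 0" using assms norm_ge_zero order_trans by blast
  have "cmod (Lap b c f x - complex_of_real (c x) * f x) \<le> (\<Sum>\<^sub>\<infinity>y. b x y) * (2 * M)"
  proof (rule norm_infsum_le[OF Lap_has_sum[OF f]])
    show "((\<lambda>y. b x y * (2 * M)) has_sum (\<Sum>\<^sub>\<infinity>y. b x y) * (2 * M)) UNIV"
      by (intro has_sum_cmult_left) simp
    fix y
    have "cmod (f x - f y) \<le> 2 * M"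
      using norm_triangle_ineq4[of "f x" "f y"] assms[of x] assms[of y] by linarith
    then show "norm (complex_of_real (b x y) * (f x - f y)) \<le> b x y * (2 * M)"
      by (simp add: norm_mult mult_left_mono)
  qed
  moreover have "cmod (complex_of_real (c x) * f x) \<le> c x * (2 * M)"
    using assms[of x] \<open>M \<ge> 0\<close> by (auto simp: norm_mult intro!: mult_left_mono)
  ultimately show ?thesis
    using norm_triangle_ineq[of "Lap b c f x - complex_of_real (c x) * f x" "complex_of_real (c x) * f x"]
    by (simp add: deg_def algebra_simps)
qed

text \<open>Multiplying Lu(y) = 0 by the conjugate of u(y) and taking real parts handles complex
  values: the edge terms T are nonnegative at a maximum of the modulus, while their sum is minus the
  killing term, so each of them is 0.\<close>

lemma harmonic_at_maximum:
  assumes u: "u \<in> linfty" and harm: "Lap b c u y = 0"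
    and max: "\<And>z. cmod (u z) \<le> cmod (u y)" and "b y z > 0"
  shows "cmod (u z) = cmod (u y)"
proof (cases "u y = 0")
  case True
  then show ?thesis using max[of z] by simp
next
  case False
  define T where "T v = b y v * ((cmod (u y))\<^sup>2 - Re (cnj (u y) * u v))" for v
  have le: "Re (cnj (u y) * u v) \<le> cmod (u y) * cmod (u v)" for v
    using complex_Re_le_cmod[of "cnj (u y) * u v"] by (simp add: norm_mult)
  have eq: "Re (cnj (u y) * (complex_of_real (b y v) * (u y - u v))) = T v" for v
    unfolding T_def cmod_power2 by (simp add: algebra_simps power2_eq_square)
  have "((\<lambda>v. cnj (u y) * (complex_of_real (b y v) * (u y - u v))) has_sum
      cnj (u y) * (0 - complex_of_real (c y) * u y)) UNIV"
    using has_sum_cmult_right[OF Lap_has_sum[OF u, of y]] harm by simp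
  then have "((\<lambda>v. Re (cnj (u y) * (complex_of_real (b y v) * (u y - u v)))) has_sum
      Re (cnj (u y) * (0 - complex_of_real (c y) * u y))) UNIV"
    by (rule has_sum_Re)
  then have "(T has_sum - (c y * (cmod (u y))\<^sup>2)) UNIV"
    unfolding eq cmod_power2 by (simp add: algebra_simps power2_eq_square)
  moreover have "T v \<ge> 0" for v
  proof -
    have "cmod (u y) * cmod (u v) \<le> (cmod (u y))\<^sup>2"
      using max[of v] by (simp add: power2_eq_square mult_left_mono)
    then show ?thesis unfolding T_def using le[of v] by simp
  qed
  ultimately have "T z = 0"
    by (intro nonneg_has_sum_le_0D[of T]) auto
  then have "(cmod (u y))\<^sup>2 \<le> cmod (u y) * cmod (u z)"
    using le[of z] \<open>b y z > 0\<close> by (simp add: T_def)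
  then have "cmod (u y) \<le> cmod (u z)" using False by (simp add: power2_eq_square)
  then show ?thesis using max[of z] by simp
qed

lemma maximum_principle:
  assumes u: "u \<in> Aalg b c" and harm: "\<And>x. Lap b c u x = 0"
    and bd: "\<And>\<gamma>. \<gamma> \<in> boundary b c \<Longrightarrow> cmod (\<gamma> u) \<le> s"
  shows "cmod (u x) \<le> s"
proof (rule ccontr)
  assume "\<not> cmod (u x) \<le> s"
  \<comment> \<open>This level exceeds s, so T is finite; it contains x, so the maximum over T is
    the global one.\<close>
  define T where "T = {y. cmod (u y) \<ge> cmod (u x)}"
  have fin: "finite T"
    unfolding T_def
    using u Aalg_subset_Aplus \<open>\<not> cmod (u x) \<le> s\<close> by (intro finite_superlevel[OF _ bd]) auto
  have "x \<in> T" by (simp add: T_def)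
  define m where "m = Max ((\<lambda>y. cmod (u y)) ` T)"
  have "m \<in> (\<lambda>y. cmod (u y)) ` T" unfolding m_def using fin \<open>x \<in> T\<close> by (intro Max_in) auto
  then obtain z where z: "z \<in> T" "cmod (u z) = m" by auto
  have le: "cmod (u y) \<le> m" for y
  proof (cases "y \<in> T")
    case True
    then show ?thesis unfolding m_def using fin by (intro Max_ge) auto
  next
    case False
    then show ?thesis using z by (simp add: T_def)
  qed
  have "cmod (u y) = m" for y
  proof (rule connected_induct[where P = "\<lambda>y. cmod (u y) = m"])
    show "cmod (u z) = m" by (rule z)
    fix v w assume "cmod (u v) = m" "b v w > 0"
    then show "cmod (u w) = m"
      using harmonic_at_maximum[of u v w] u Aalg_linfty harm le by auto
  qed
  then have "T = UNIV" using z by (simp add: T_def)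
  then show False using fin infinite_UNIV by simp
qed

text \<open>Stated with limits in both conclusions because it is used twice: minimising sequences
  have fixed boundary values but only asymptotically vanishing Laplacian, while the later
  approximating solutions are harmonic with only converging boundary values.\<close>

lemma harmonic_limit:
  assumes u: "\<And>n. u n \<in> Aalg b c"
    and cauchy: "\<And>e. e > 0 \<Longrightarrow> \<exists>N. \<forall>m\<ge>N. \<forall>n\<ge>N. \<forall>x. cmod (u m x - u n x) \<le> e"
    and harm: "\<And>x. (\<lambda>n. Lap b c (u n) x) \<longlonglongrightarrow> 0"
    and bdry: "\<And>\<gamma>. \<gamma> \<in> boundary b c \<Longrightarrow> (\<lambda>n. \<gamma> (u n)) \<longlonglongrightarrow> \<psi> \<gamma>"
  shows "\<exists>v\<in>Aalg b c. (\<forall>x. Lap b c v x = 0) \<and> (\<forall>\<gamma>\<in>boundary b c. \<gamma> v = \<psi> \<gamma>)"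
proof -
  have "Cauchy (\<lambda>n. u n x)" for x
  proof (rule metric_CauchyI)
    fix e :: real assume "e > 0"
    then obtain N where N: "\<forall>m\<ge>N. \<forall>n\<ge>N. \<forall>x. cmod (u m x - u n x) \<le> e/2"
      using cauchy[of "e/2"] by auto
    show "\<exists>M. \<forall>m\<ge>M. \<forall>n\<ge>M. dist (u m x) (u n x) < e"
    proof (intro exI allI impI)
      fix m n assume "m \<ge> N" "n \<ge> N"
      then have "cmod (u m x - u n x) \<le> e/2" using N by blast
      then show "dist (u m x) (u n x) < e" using \<open>e > 0\<close> by (simp add: dist_norm)
    qed
  qed
  then have "\<exists>l. (\<lambda>n. u n x) \<longlonglongrightarrow> l" for x
    by (simp add: Cauchy_convergent_iff convergent_def)
  then obtain v where v: "\<And>x. (\<lambda>n. u n x) \<longlonglongrightarrow> v x" by metis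
  have unif: "\<forall>\<^sub>F n in sequentially. \<forall>x. cmod (u n x - v x) \<le> e" if "e > 0" for e
  proof -
    obtain N where N: "\<forall>m\<ge>N. \<forall>n\<ge>N. \<forall>x. cmod (u m x - u n x) \<le> e"
      using cauchy[OF \<open>e > 0\<close>] by blast
    have "cmod (u n x - v x) \<le> e" if "n \<ge> N" for n x
    proof (rule LIMSEQ_le_const2)
      show "(\<lambda>k. cmod (u n x - u k x)) \<longlonglongrightarrow> cmod (u n x - v x)"
        by (intro tendsto_intros v)
      show "\<exists>M. \<forall>k\<ge>M. cmod (u n x - u k x) \<le> e" using N that by blast
    qed
    then show ?thesis by (auto simp: eventually_sequentially)
  qed
  have "v \<in> sup_closure (Aalg b c)"
  proof (rule sup_closureI[OF Aalg_linfty])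
    fix e :: real assume "e > 0"
    then obtain n where "\<And>x. cmod (u n x - v x) \<le> e"
      using eventually_happens[OF unif] sequentially_bot by blast
    then show "\<exists>g\<in>Aalg b c. \<forall>x. cmod (v x - g x) \<le> e"
      using u by (metis norm_minus_commute)
  qed
  then have vA: "v \<in> Aalg b c" using Aalg_closed by blast
  have uv: "(\<lambda>x. u n x - v x) \<in> Aplus b c" for n
    using Aalg_diff[OF u vA] Aalg_subset_Aplus by blast
  have "Lap b c v x = 0" for x
  proof -
    have "(\<lambda>n. Lap b c (u n) x - Lap b c v x) \<longlonglongrightarrow> 0"
    proof (rule tendstoI)
      fix e :: real assume "e > 0"
      define d where "d = e / (2 * \<bar>deg x\<bar> + 1)"
      have "d > 0" using \<open>e > 0\<close> by (simp add: d_def)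
      from unif[OF this] show "\<forall>\<^sub>F n in sequentially. dist (Lap b c (u n) x - Lap b c v x) 0 < e"
      proof eventually_elim
        case (elim n)
        then have "cmod (Lap b c (\<lambda>x. u n x - v x) x) \<le> 2 * deg x * d"
          by (intro Lap_bound) auto
        also have "\<dots> < (2 * \<bar>deg x\<bar> + 1) * d"
          using \<open>d > 0\<close> by (intro mult_strict_right_mono) auto
        also have "\<dots> = e" by (simp add: d_def)
        finally have "cmod (Lap b c (\<lambda>x. u n x - v x) x) < e" .
        then show ?case
          using Lap_diff[of "u n" v x] u[of n] vA Aalg_linfty
          by (simp add: subsetD[OF Aalg_linfty])
      qed
    qed
    then have "(\<lambda>n. Lap b c (u n) x) \<longlonglongrightarrow> Lap b c v x" by (simp add: LIM_zero_iff)
    then show ?thesis using harm LIMSEQ_unique by blast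
  qed
  moreover have "\<gamma> v = \<psi> \<gamma>" if \<gamma>: "\<gamma> \<in> boundary b c" for \<gamma>
  proof -
    note ch = boundary_char[OF \<gamma>]
    have "(\<lambda>n. \<gamma> (u n) - \<gamma> v) \<longlonglongrightarrow> 0"
    proof (rule tendstoI)
      fix e :: real assume "e > 0"
      then have "e/2 > 0" by simp
      from unif[OF this] show "\<forall>\<^sub>F n in sequentially. dist (\<gamma> (u n) - \<gamma> v) 0 < e"
      proof eventually_elim
        case (elim n)
        then have "cmod (\<gamma> (\<lambda>x. u n x - v x)) \<le> e/2" by (intro char_bound[OF ch uv]) auto
        then show ?case
          using \<open>e > 0\<close>
          by (simp add: char_diff[OF ch subsetD[OF Aalg_subset_Aplus u] subsetD[OF Aalg_subset_Aplus vA]])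
      qed
    qed
    then have "(\<lambda>n. \<gamma> (u n)) \<longlonglongrightarrow> \<gamma> v" by (simp add: LIM_zero_iff)
    then show ?thesis using bdry[OF \<gamma>] LIMSEQ_unique by blast
  qed
  ultimately show ?thesis using vA by blast
qed


section \<open>Energy\<close>

text \<open>The form Q~. A divergent sum counts as 0 here, so the value is meaningful only on
  \<open>Dtilde\<close>.\<close>

definition energy :: "('x \<Rightarrow> complex) \<Rightarrow> real" where
  "energy f = (\<Sum>\<^sub>\<infinity>(x, y). b x y * (cmod (f x - f y))\<^sup>2) / 2 + (\<Sum>\<^sub>\<infinity>x. c x * (cmod (f x))\<^sup>2)"

lemma energy_parts_nonneg:
  "(\<Sum>\<^sub>\<infinity>(x, y). b x y * (cmod (f x - f y))\<^sup>2) \<ge> 0" "(\<Sum>\<^sub>\<infinity>x. c x * (cmod (f x))\<^sup>2) \<ge> 0"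
  by (auto intro!: infsum_nonneg)

lemma energy_nonneg: "energy f \<ge> 0"
  using energy_parts_nonneg[of f] by (simp add: energy_def)

lemma Dtilde_summable:
  assumes "f \<in> Dtilde b c"
  shows "(\<lambda>(x, y). b x y * (cmod (f x - f y))\<^sup>2) summable_on UNIV"
    and "(\<lambda>x. c x * (cmod (f x))\<^sup>2) summable_on UNIV"
  using assms by (auto simp: Dtilde_def)

lemma energy_scale: "energy (\<lambda>x. a * f x) = (cmod a)\<^sup>2 * energy f"
proof -
  have "(\<Sum>\<^sub>\<infinity>(x, y). b x y * (cmod (a * f x - a * f y))\<^sup>2)
      = (\<Sum>\<^sub>\<infinity>p. (cmod a)\<^sup>2 * (case p of (x, y) \<Rightarrow> b x y * (cmod (f x - f y))\<^sup>2))"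
  proof (rule infsum_cong)
    fix p :: "'x \<times> 'x"
    have "cmod (a * z - a * w) = cmod a * cmod (z - w)" for z w
      by (metis norm_mult right_diff_distrib)
    then show "(case p of (x, y) \<Rightarrow> b x y * (cmod (a * f x - a * f y))\<^sup>2)
        = (cmod a)\<^sup>2 * (case p of (x, y) \<Rightarrow> b x y * (cmod (f x - f y))\<^sup>2)"
      by (simp add: case_prod_unfold power_mult_distrib)
  qed
  moreover have "(\<Sum>\<^sub>\<infinity>x. c x * (cmod (a * f x))\<^sup>2) = (\<Sum>\<^sub>\<infinity>x. (cmod a)\<^sup>2 * (c x * (cmod (f x))\<^sup>2))"
    by (simp add: norm_mult power_mult_distrib algebra_simps)
  ultimately show ?thesis
    by (simp add: energy_def infsum_cmult_right' distrib_left)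
qed

text \<open>Used to show that minimising sequences are Cauchy in energy.\<close>

lemma energy_parallelogram:
  assumes f: "f \<in> Dtilde b c" and g: "g \<in> Dtilde b c"
  shows "energy (\<lambda>x. f x + g x) + energy (\<lambda>x. f x - g x) = 2 * energy f + 2 * energy g"
proof -
  have par: "(cmod (z + w))\<^sup>2 + (cmod (z - w))\<^sup>2 = 2 * (cmod z)\<^sup>2 + 2 * (cmod w)\<^sup>2" for z w
    unfolding cmod_power2 by (simp add: power2_eq_square algebra_simps)
  let ?E = "\<lambda>f (x, y). b x y * (cmod (f x - f y))\<^sup>2" and ?C = "\<lambda>f x. c x * (cmod (f x))\<^sup>2"
  note sf = Dtilde_summable[OF f] and sg = Dtilde_summable[OF g]
    and sp = Dtilde_summable[OF Dtilde_add[OF f g]] and sm = Dtilde_summable[OF Dtilde_diff[OF f g]]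
  have "infsum (?E (\<lambda>x. f x + g x)) UNIV + infsum (?E (\<lambda>x. f x - g x)) UNIV
      = infsum (\<lambda>p. ?E (\<lambda>x. f x + g x) p + ?E (\<lambda>x. f x - g x) p) UNIV"
    by (rule infsum_add[symmetric, OF sp(1) sm(1)])
  also have "\<dots> = infsum (\<lambda>p. 2 * ?E f p + 2 * ?E g p) UNIV"
  proof (rule infsum_cong)
    fix p :: "'x \<times> 'x"
    obtain x y where p: "p = (x, y)" by force
    show "?E (\<lambda>x. f x + g x) p + ?E (\<lambda>x. f x - g x) p = 2 * ?E f p + 2 * ?E g p"
      using arg_cong[OF par[of "f x - f y" "g x - g y"], of "\<lambda>t. b x y * t"]
      by (simp add: p algebra_simps)
  qed
  also have "\<dots> = infsum (\<lambda>p. 2 * ?E f p) UNIV + infsum (\<lambda>p. 2 * ?E g p) UNIV"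
    by (intro infsum_add summable_on_cmult_right sf(1) sg(1))
  also have "\<dots> = 2 * infsum (?E f) UNIV + 2 * infsum (?E g) UNIV"
    by (simp only: infsum_cmult_right')
  finally have 1: "infsum (?E (\<lambda>x. f x + g x)) UNIV + infsum (?E (\<lambda>x. f x - g x)) UNIV
      = 2 * infsum (?E f) UNIV + 2 * infsum (?E g) UNIV" .
  have "infsum (?C (\<lambda>x. f x + g x)) UNIV + infsum (?C (\<lambda>x. f x - g x)) UNIV
      = infsum (\<lambda>x. ?C (\<lambda>x. f x + g x) x + ?C (\<lambda>x. f x - g x) x) UNIV"
    by (rule infsum_add[symmetric, OF sp(2) sm(2)])
  also have "\<dots> = infsum (\<lambda>x. 2 * ?C f x + 2 * ?C g x) UNIV"
  proof (rule infsum_cong)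
    fix x
    show "?C (\<lambda>x. f x + g x) x + ?C (\<lambda>x. f x - g x) x = 2 * ?C f x + 2 * ?C g x"
      using arg_cong[OF par[of "f x" "g x"], of "\<lambda>t. c x * t"] by (simp add: algebra_simps)
  qed
  also have "\<dots> = infsum (\<lambda>x. 2 * ?C f x) UNIV + infsum (\<lambda>x. 2 * ?C g x) UNIV"
    by (intro infsum_add summable_on_cmult_right sf(2) sg(2))
  also have "\<dots> = 2 * infsum (?C f) UNIV + 2 * infsum (?C g) UNIV"
    by (simp only: infsum_cmult_right')
  finally have 2: "infsum (?C (\<lambda>x. f x + g x)) UNIV + infsum (?C (\<lambda>x. f x - g x)) UNIV
      = 2 * infsum (?C f) UNIV + 2 * infsum (?C g) UNIV" .
  show ?thesis using 1 2 unfolding energy_def by argo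
qed

text \<open>One ordered pair enters the energy with weight one half, hence the factor 2.\<close>

lemma edge_le_energy:
  assumes "f \<in> Dtilde b c"
  shows "b x y * (cmod (f x - f y))\<^sup>2 \<le> 2 * energy f"
proof -
  have "(\<Sum>p\<in>{(x, y)}. case p of (x, y) \<Rightarrow> b x y * (cmod (f x - f y))\<^sup>2)
      \<le> (\<Sum>\<^sub>\<infinity>(x, y). b x y * (cmod (f x - f y))\<^sup>2)"
    by (rule finite_sum_le_infsum[OF Dtilde_summable(1)[OF assms]]) auto
  then show ?thesis using energy_parts_nonneg[of f] by (simp add: energy_def)
qed

lemma vertex_le_energy:
  assumes "f \<in> Dtilde b c"
  shows "c x * (cmod (f x))\<^sup>2 \<le> energy f"
proof -
  have "(\<Sum>x\<in>{x}. c x * (cmod (f x))\<^sup>2) \<le> (\<Sum>\<^sub>\<infinity>x. c x * (cmod (f x))\<^sup>2)"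
    by (rule finite_sum_le_infsum[OF Dtilde_summable(2)[OF assms]]) auto
  then show ?thesis using energy_parts_nonneg[of f] by (simp add: energy_def)
qed

text \<open>A change at x affects only the row and the column of x. By symmetry they contribute
  equally, which cancels the factor one half, and the linear coefficient becomes the
  Laplacian.\<close>

lemma energy_variation:
  assumes h: "h \<in> Dtilde b c"
  shows "energy (\<lambda>y. h y + a * point x y) = energy h + 2 * Re (cnj a * Lap b c h x) + (cmod a)\<^sup>2 * deg x"
proof -
  let ?E = "\<lambda>f (x, y). b x y * (cmod (f x - f y))\<^sup>2" and ?C = "\<lambda>f x. c x * (cmod (f x))\<^sup>2"
  let ?h = "\<lambda>y. h y + a * point x y"
  have hl: "h \<in> linfty" using h Dtilde_linfty by blast
  have sq: "(cmod (z + a))\<^sup>2 = (cmod z)\<^sup>2 + (2 * Re (cnj a * z) + (cmod a)\<^sup>2)" for z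
    unfolding cmod_power2 by (simp add: power2_eq_square algebra_simps)
  have sq': "(cmod (z - a))\<^sup>2 = (cmod z)\<^sup>2 + (2 * Re (cnj a * (- z)) + (cmod a)\<^sup>2)" for z
    unfolding cmod_power2 by (simp add: power2_eq_square algebra_simps)
  \<comment> \<open>Change of the edge term of (x, y), with total S.\<close>
  define A where "A y = b x y * (2 * Re (cnj a * (h x - h y)) + (cmod a)\<^sup>2)" for y
  define S where "S = 2 * Re (cnj a * (Lap b c h x - complex_of_real (c x) * h x))
      + (\<Sum>\<^sub>\<infinity>y. b x y) * (cmod a)\<^sup>2"
  have A: "(A has_sum S) UNIV"
  proof -
    have "((\<lambda>y. 2 * Re (cnj a * (complex_of_real (b x y) * (h x - h y))) + b x y * (cmod a)\<^sup>2) has_sum S) UNIV"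
      unfolding S_def
      by (intro has_sum_add has_sum_cmult_right has_sum_Re Lap_has_sum[OF hl] has_sum_cmult_left) simp
    also have "(\<lambda>y. 2 * Re (cnj a * (complex_of_real (b x y) * (h x - h y))) + b x y * (cmod a)\<^sup>2) = A"
      by (simp add: A_def fun_eq_iff algebra_simps)
    finally show ?thesis .
  qed
  have "((\<lambda>(u, v). A v) has_sum S) ({x} \<times> UNIV)"
    using A by (subst has_sum_reindex_bij_witness[where i = "Pair x" and j = snd and T = UNIV and h = A]) auto
  then have "((\<lambda>(u, v). if u = x then A v else 0) has_sum S) UNIV"
    by (rule has_sum_cong_neutral[THEN iffD1, rotated -1]) (auto split: if_splits)
  moreover from this have "((\<lambda>(u, v). if v = x then A u else 0) has_sum S) UNIV"
    using has_sum_swap[of "\<lambda>(u, v). if u = x then A v else 0" UNIV UNIV S] by simp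
  ultimately have "((\<lambda>p. ?E h p + ((case p of (u, v) \<Rightarrow> if u = x then A v else 0)
      + (case p of (u, v) \<Rightarrow> if v = x then A u else 0))) has_sum (infsum (?E h) UNIV + (S + S))) UNIV"
    using Dtilde_summable(1)[OF h] by (intro has_sum_add) simp_all
  moreover have "?E h p + ((case p of (u, v) \<Rightarrow> if u = x then A v else 0)
      + (case p of (u, v) \<Rightarrow> if v = x then A u else 0)) = ?E ?h p" for p
  proof -
    obtain u v where p: "p = (u, v)" by force
    consider "u \<noteq> x" "v \<noteq> x" | "u = x" "v \<noteq> x" | "u \<noteq> x" "v = x" | "u = x" "v = x" by blast
    then show ?thesis
    proof cases
      case 1
      then show ?thesis by (simp add: p point_def)
    next
      case 2
      then have "?E ?h p = b x v * (cmod ((h x - h v) + a))\<^sup>2"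
        by (simp add: p point_def algebra_simps)
      then show ?thesis using 2 unfolding sq by (simp add: p A_def distrib_left)
    next
      case 3
      then have "?E ?h p = b x u * (cmod ((h u - h x) - a))\<^sup>2"
        by (simp add: p point_def algebra_simps b_sym[of u x])
      then show ?thesis using 3 unfolding sq' by (simp add: p A_def distrib_left b_sym[of u x])
    next
      \<comment> \<open>The diagonal pair is counted in both row and column, harmlessly since b x x
        = 0.\<close>
      case 4
      then show ?thesis by (simp add: p A_def)
    qed
  qed
  ultimately have E: "infsum (?E ?h) UNIV = infsum (?E h) UNIV + 2 * S"
    by (simp add: infsumI)
  define B where "B = c x * (2 * Re (cnj a * h x) + (cmod a)\<^sup>2)"
  have "((\<lambda>u. if u = x then B else 0) has_sum B) {x}"
    by (rule has_sum_finiteI) auto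
  then have "((\<lambda>u. if u = x then B else 0) has_sum B) UNIV"
    by (rule has_sum_cong_neutral[THEN iffD1, rotated -1]) (auto split: if_splits)
  then have "((\<lambda>u. ?C h u + (if u = x then B else 0)) has_sum (infsum (?C h) UNIV + B)) UNIV"
    using Dtilde_summable(2)[OF h] by (intro has_sum_add) simp_all
  moreover have "?C h u + (if u = x then B else 0) = ?C ?h u" for u
    by (cases "u = x") (simp_all add: point_def B_def sq distrib_left)
  ultimately have C: "infsum (?C ?h) UNIV = infsum (?C h) UNIV + B"
    by (simp add: infsumI)
  have "S + B = 2 * Re (cnj a * Lap b c h x) + (cmod a)\<^sup>2 * deg x"
    by (simp add: S_def B_def deg_def algebra_simps)
  then show ?thesis unfolding energy_def E C by argo
qed

text \<open>Almost minimal energy forces an almost vanishing Laplacian, so no minimum has to be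
  attained. Inserting a suitable a into the quadratic expansion gives the bound.\<close>

lemma Lap_le_energy_excess:
  assumes h: "h \<in> Dtilde b c" and min: "\<And>a. m \<le> energy (\<lambda>y. h y + a * point x y)"
  shows "(cmod (Lap b c h x))\<^sup>2 \<le> (energy h - m) * (deg x + 1)"
proof -
  have "deg x \<ge> 0" by (simp add: deg_def infsum_nonneg)
  \<comment> \<open>The added 1 makes the divisor positive at once and only worsens the
    constant.\<close>
  define d where "d = deg x + 1"
  have d: "d > 0" using \<open>deg x \<ge> 0\<close> by (simp add: d_def)
  define L where "L = Lap b c h x"
  define a where "a = - L / complex_of_real d"
  have "Re (cnj a * L) = - ((cmod L)\<^sup>2 / d)"
    using d unfolding cmod_power2 by (simp add: a_def power2_eq_square field_simps)
  moreover have "(cmod a)\<^sup>2 = (cmod L)\<^sup>2 / d\<^sup>2"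
    using d by (simp add: a_def norm_divide power_divide)
  ultimately have "m \<le> energy h - 2 * ((cmod L)\<^sup>2 / d) + (cmod L)\<^sup>2 / d\<^sup>2 * deg x"
    using min[of a] unfolding energy_variation[OF h] L_def[symmetric] by simp
  also have "(cmod L)\<^sup>2 / d\<^sup>2 * deg x \<le> (cmod L)\<^sup>2 / d\<^sup>2 * d"
    by (intro mult_left_mono) (auto simp: d_def)
  also have "(cmod L)\<^sup>2 / d\<^sup>2 * d = (cmod L)\<^sup>2 / d"
    using d by (simp add: power2_eq_square)
  finally have "(cmod L)\<^sup>2 / d \<le> energy h - m" by simp
  then show ?thesis using d by (simp add: pos_divide_le_eq L_def d_def)
qed

end

section \<open>Finitely supported functions are uniformly controlled by their energy\<close>

text \<open>A supremum is at most the square root of the sum of squares; exchanging the sums bounds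
  the total by the sum of e. D is constrained only through bounds common to all d n, which also
  covers differences of suprema along edges.\<close>

lemma summable_on_sup_square:
  fixes w :: "'p \<Rightarrow> real" and d :: "nat \<Rightarrow> 'p \<Rightarrow> real"
  assumes w: "\<And>p. w p \<ge> 0" and d: "\<And>n p. d n p \<ge> 0" and D: "\<And>p. D p \<ge> 0"
    and sup: "\<And>p s. s \<ge> 0 \<Longrightarrow> (\<And>n. d n p \<le> s) \<Longrightarrow> D p \<le> s"
    and sum: "\<And>n. (\<lambda>p. w p * (d n p)\<^sup>2) summable_on UNIV"
    and le: "\<And>n. (\<Sum>\<^sub>\<infinity>p. w p * (d n p)\<^sup>2) \<le> e n" and e: "summable e"
  shows "(\<lambda>p. w p * (D p)\<^sup>2) summable_on UNIV"
proof (rule nonneg_bdd_above_summable_on)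
  have fin: "(\<Sum>p\<in>F. w p * (d n p)\<^sup>2) \<le> e n" if "finite F" for F n
    using finite_sum_le_infsum[OF sum that, of n] le[of n] w by simp
  have term_le: "w p * (d n p)\<^sup>2 \<le> e n" for n p
    using fin[of "{p}" n] by simp
  have summ: "summable (\<lambda>n. w p * (d n p)\<^sup>2)" for p
    by (rule summable_comparison_test'[OF e, of 0]) (use term_le w in auto)
  have pt: "w p * (D p)\<^sup>2 \<le> (\<Sum>n. w p * (d n p)\<^sup>2)" for p
  proof (cases "w p = 0")
    case False
    then have "w p > 0" using w[of p] by simp
    \<comment> \<open>The l2 norm of the sequence d n p. Its finiteness is known only through the
      weighted sum, hence the separate case w p = 0.\<close>
    define s where "s = sqrt ((\<Sum>n. w p * (d n p)\<^sup>2) / w p)"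
    have nn: "(\<Sum>n. w p * (d n p)\<^sup>2) \<ge> 0"
      by (intro suminf_nonneg summ) (use w in auto)
    have "D p \<le> s"
    proof (rule sup)
      show "s \<ge> 0" using nn \<open>w p > 0\<close> by (simp add: s_def)
      fix n
      have "w p * (d n p)\<^sup>2 \<le> (\<Sum>n. w p * (d n p)\<^sup>2)"
        using sum_le_suminf[OF summ, of "{n}" p] w by simp
      then have "(d n p)\<^sup>2 \<le> (\<Sum>n. w p * (d n p)\<^sup>2) / w p"
        using \<open>w p > 0\<close> by (simp add: pos_le_divide_eq mult.commute)
      then show "d n p \<le> s" unfolding s_def by (rule real_le_rsqrt)
    qed
    then have "(D p)\<^sup>2 \<le> s\<^sup>2" using D by (intro power_mono) auto
    also have "s\<^sup>2 = (\<Sum>n. w p * (d n p)\<^sup>2) / w p"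
      using nn \<open>w p > 0\<close> by (simp add: s_def)
    finally show ?thesis using \<open>w p > 0\<close> by (simp add: pos_le_divide_eq mult.commute)
  qed simp
  show "bdd_above (sum (\<lambda>p. w p * (D p)\<^sup>2) ` {F. F \<subseteq> UNIV \<and> finite F})"
  proof (rule bdd_aboveI2)
    fix F assume "F \<in> {F. F \<subseteq> (UNIV :: 'p set) \<and> finite F}"
    then have F: "finite F" by simp
    have "(\<Sum>p\<in>F. w p * (D p)\<^sup>2) \<le> (\<Sum>p\<in>F. \<Sum>n. w p * (d n p)\<^sup>2)"
      by (intro sum_mono pt)
    also have "\<dots> = (\<Sum>n. \<Sum>p\<in>F. w p * (d n p)\<^sup>2)"
      by (rule suminf_sum[symmetric]) (rule summ)
    also have "\<dots> \<le> (\<Sum>n. e n)"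
      by (intro suminf_le fin F summable_sum summ e)
    finally show "(\<Sum>p\<in>F. w p * (D p)\<^sup>2) \<le> (\<Sum>n. e n)" .
  qed
qed (use w in simp)

context compactifiable_graph
begin

text \<open>A gliding hump: otherwise the pointwise supremum of suitably normalised functions would be
  unbounded and still of finite energy.\<close>

lemma uniform_bound_of_pointwise_bound:
  assumes V: "V \<subseteq> Dtilde b c" and scale: "\<And>f a. f \<in> V \<Longrightarrow> (\<lambda>x. a * f x) \<in> V"
    and pt: "\<And>x. \<exists>K. \<forall>f\<in>V. cmod (f x) \<le> K * sqrt (energy f)"
  shows "\<exists>K. \<forall>f\<in>V. \<forall>x. cmod (f x) \<le> K * sqrt (energy f)"
proof (rule ccontr)
  assume neg: "\<not> ?thesis"
  have "\<exists>f x. f \<in> V \<and> 4 ^ n * sqrt (energy f) < cmod (f x)" for n :: nat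
  proof (rule ccontr)
    assume "\<not> ?thesis"
    then have "\<forall>f\<in>V. \<forall>x. cmod (f x) \<le> 4 ^ n * sqrt (energy f)" by (meson not_le)
    with neg show False by blast
  qed
  then obtain f z where f: "\<And>n. f n \<in> V" "\<And>n. 4 ^ n * sqrt (energy (f n)) < cmod (f n (z n))"
    by metis
  define s where "s n = sqrt (energy (f n))" for n
  obtain K where K: "\<And>x g. g \<in> V \<Longrightarrow> cmod (g x) \<le> K x * sqrt (energy g)"
    using pt by metis
  \<comment> \<open>With zero energy the pointwise bound would give f n (z n) = 0, against the
    strict inequality.\<close>
  have s: "s n > 0" for n
  proof (rule ccontr)
    assume "\<not> ?thesis"
    then have "s n = 0" using energy_nonneg[of "f n"] by (simp add: s_def)
    then show False using K[OF f(1)[of n], of "z n"] f(2)[of n] by (simp add: s_def)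
  qed
  \<comment> \<open>Of the factor \<open>4 ^ n\<close>, one \<open>2 ^ n\<close> is given away to
    make the energies summable; the other survives as growth at z n.\<close>
  define r where "r n = inverse (2 ^ n * s n)" for n
  have four: "(4::real) ^ n = 2 ^ n * 2 ^ n" for n
    by (simp flip: power_mult_distrib)
  define g where "g n = (\<lambda>x. complex_of_real (r n) * f n x)" for n
  have gV: "g n \<in> V" for n unfolding g_def by (rule scale[OF f(1)])
  have r: "r n > 0" for n using s by (simp add: r_def)
  have "energy (g n) = (r n)\<^sup>2 * (s n)\<^sup>2" for n
    using r[of n] energy_nonneg[of "f n"] unfolding g_def energy_scale by (simp add: s_def)
  also have "(r n)\<^sup>2 * (s n)\<^sup>2 = (1/4) ^ n" for n
    using s[of n] by (simp add: r_def power2_eq_square power_one_over four field_simps)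
  finally have eg: "energy (g n) = (1/4) ^ n" for n .
  have big: "2 ^ n < cmod (g n (z n))" for n
  proof -
    have "r n * (4 ^ n * s n) < r n * cmod (f n (z n))"
      using f(2)[of n] r[of n] by (simp add: s_def)
    moreover have "r n * (4 ^ n * s n) = 2 ^ n"
      using s[of n] by (simp add: r_def four field_simps)
    ultimately show ?thesis using r[of n] by (simp add: g_def norm_mult)
  qed
  have bdd: "bdd_above (range (\<lambda>n. cmod (g n x)))" for x
  proof (rule bdd_aboveI2)
    fix n
    have "cmod (g n x) \<le> K x * sqrt ((1/4) ^ n)" using K[OF gV[of n], of x] eg[of n] by simp
    also have "\<dots> \<le> \<bar>K x\<bar> * 1"
      by (intro mult_mono) (auto simp: power_le_one)
    finally show "cmod (g n x) \<le> \<bar>K x\<bar>" by simp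
  qed
  \<comment> \<open>The pointwise bounds make this supremum finite at each vertex.\<close>
  define G where "G x = (SUP n. cmod (g n x))" for x
  have up: "cmod (g n x) \<le> G x" for n x
    unfolding G_def using bdd by (intro cSUP_upper) auto
  have least: "G x \<le> t" if "\<And>n. cmod (g n x) \<le> t" for x t
    unfolding G_def using that by (intro cSUP_least) auto
  have G0: "G x \<ge> 0" for x using up[of 0 x] norm_ge_zero order_trans by blast
  have gD: "g n \<in> Dtilde b c" for n using gV V by blast
  \<comment> \<open>The factor 2 undoes the one half in front of the edge sum.\<close>
  have e: "summable (\<lambda>n. 2 * (1/4 :: real) ^ n)" by (intro summable_mult) simp
  have G_lip: "G x - G y \<le> t" if "\<And>n. cmod (g n x - g n y) \<le> t" for x y t
  proof -
    have "G x \<le> G y + t"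
    proof (rule least)
      fix n
      show "cmod (g n x) \<le> G y + t"
        using that[of n] up[of n y] norm_triangle_ineq2[of "g n x" "g n y"] by linarith
    qed
    then show ?thesis by simp
  qed
  have "(\<lambda>p. (case p of (x, y) \<Rightarrow> b x y) * (case p of (x, y) \<Rightarrow> \<bar>G x - G y\<bar>)\<^sup>2) summable_on UNIV"
  proof (rule summable_on_sup_square[where d = "\<lambda>n (x, y). cmod (g n x - g n y)" and e = "\<lambda>n. 2 * (1/4) ^ n"])
    fix p :: "'x \<times> 'x" and t :: real
    assume t: "\<And>n. (case p of (x, y) \<Rightarrow> cmod (g n x - g n y)) \<le> t"
    obtain x y where p: "p = (x, y)" by force
    have "cmod (g n x - g n y) \<le> t" "cmod (g n y - g n x) \<le> t" for n
      using t[of n] by (simp_all add: p norm_minus_commute)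
    then show "(case p of (x, y) \<Rightarrow> \<bar>G x - G y\<bar>) \<le> t"
      using G_lip[of x y t] G_lip[of y x t] by (simp add: p)
  next
    fix n
    show "(\<lambda>p. (case p of (x, y) \<Rightarrow> b x y) * (case p of (x, y) \<Rightarrow> cmod (g n x - g n y))\<^sup>2) summable_on UNIV"
      using Dtilde_summable(1)[OF gD[of n]] by (simp add: case_prod_unfold)
    show "(\<Sum>\<^sub>\<infinity>p. (case p of (x, y) \<Rightarrow> b x y) * (case p of (x, y) \<Rightarrow> cmod (g n x - g n y))\<^sup>2) \<le> 2 * (1/4) ^ n"
      using energy_parts_nonneg[of "g n"] eg[of n] by (simp add: energy_def case_prod_unfold)
  qed (auto intro: e)
  moreover have "(\<lambda>x. c x * (G x)\<^sup>2) summable_on UNIV"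
  proof (rule summable_on_sup_square[where d = "\<lambda>n x. cmod (g n x)" and e = "\<lambda>n. 2 * (1/4) ^ n"])
    fix n
    show "(\<lambda>x. c x * (cmod (g n x))\<^sup>2) summable_on UNIV"
      by (rule Dtilde_summable(2)[OF gD])
    show "(\<Sum>\<^sub>\<infinity>x. c x * (cmod (g n x))\<^sup>2) \<le> 2 * (1/4) ^ n"
      using energy_parts_nonneg[of "g n"] eg[of n] zero_le_power[of "1/4 :: real" n] unfolding energy_def by linarith
  qed (auto intro: e G0 least)
  ultimately have "(\<lambda>x. complex_of_real (G x)) \<in> Dtilde b c"
    by (simp add: Dtilde_def case_prod_unfold flip: of_real_diff)
  then have "(\<lambda>x. complex_of_real (G x)) \<in> linfty" using Dtilde_linfty by blast
  then obtain M where M: "\<And>x. cmod (complex_of_real (G x)) \<le> M"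
    unfolding linfty_iff by blast
  obtain n where "M < 2 ^ n" using real_arch_pow[of 2 M] by auto
  moreover have "cmod (complex_of_real (G (z n))) = G (z n)" using G0[of "z n"] by simp
  ultimately show False using big[of n] up[of n "z n"] M[of "z n"] by linarith
qed

text \<open>Each edge of a path costs a factor sqrt (2 / b y z), and the costs add up. Only
  differences are controlled, as energy may not see constants.\<close>

lemma pointwise_difference_bound:
  "\<exists>K. \<forall>f\<in>Dtilde b c. cmod (f y - f x) \<le> K * sqrt (energy f)"
proof (rule connected_induct[where x = x])
  show "\<exists>K. \<forall>f\<in>Dtilde b c. cmod (f x - f x) \<le> K * sqrt (energy f)"
    by (intro exI[of _ 0]) simp
  fix y z assume "\<exists>K. \<forall>f\<in>Dtilde b c. cmod (f y - f x) \<le> K * sqrt (energy f)" and "b y z > 0"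
  then obtain K where K: "\<And>f. f \<in> Dtilde b c \<Longrightarrow> cmod (f y - f x) \<le> K * sqrt (energy f)" by blast
  have "cmod (f z - f x) \<le> (K + sqrt (2 / b y z)) * sqrt (energy f)" if f: "f \<in> Dtilde b c" for f
  proof -
    have "(cmod (f y - f z))\<^sup>2 \<le> 2 / b y z * energy f"
      using edge_le_energy[OF f, of y z] \<open>b y z > 0\<close> by (simp add: field_simps)
    then have "cmod (f y - f z) \<le> sqrt (2 / b y z * energy f)" by (rule real_le_rsqrt)
    then have "cmod (f y - f z) \<le> sqrt (2 / b y z) * sqrt (energy f)"
      by (simp only: real_sqrt_mult)
    moreover have "cmod (f z - f x) \<le> cmod (f y - f x) + cmod (f y - f z)"
      using norm_triangle_ineq4[of "f y - f x" "f y - f z"] by simp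
    ultimately show ?thesis using K[OF f] by (simp add: distrib_right)
  qed
  then show "\<exists>K. \<forall>f\<in>Dtilde b c. cmod (f z - f x) \<le> K * sqrt (energy f)" by blast
qed

text \<open>The gliding hump needs an anchor: a vertex w whose value the energy controls. Any w with
  c w > 0 will do. If c = 0, functions are normalised to vanish at w, which leaves the energy
  unchanged.\<close>

lemma finite_support_bound:
  "\<exists>K. \<forall>g. finite {x. g x \<noteq> 0} \<longrightarrow> (\<forall>x. cmod (g x) \<le> K * sqrt (energy g))"
proof (cases "\<exists>w. c w > 0")
  case True
  then obtain w where w: "c w > 0" by blast
  have "\<exists>K. \<forall>f\<in>Dtilde b c. \<forall>x. cmod (f x) \<le> K * sqrt (energy f)"
  proof (rule uniform_bound_of_pointwise_bound)
    fix x
    obtain K where K: "\<And>f. f \<in> Dtilde b c \<Longrightarrow> cmod (f x - f w) \<le> K * sqrt (energy f)"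
      using pointwise_difference_bound by blast
    have "cmod (f x) \<le> (K + sqrt (1 / c w)) * sqrt (energy f)" if f: "f \<in> Dtilde b c" for f
    proof -
      have "(cmod (f w))\<^sup>2 \<le> 1 / c w * energy f"
        using vertex_le_energy[OF f, of w] w by (simp add: field_simps)
      then have "cmod (f w) \<le> sqrt (1 / c w * energy f)" by (rule real_le_rsqrt)
      then have "cmod (f w) \<le> sqrt (1 / c w) * sqrt (energy f)" by (simp only: real_sqrt_mult)
      then show ?thesis
        using K[OF f] norm_triangle_ineq[of "f x - f w" "f w"] by (simp add: distrib_right)
    qed
    then show "\<exists>K. \<forall>f\<in>Dtilde b c. cmod (f x) \<le> K * sqrt (energy f)" by blast
  qed (auto intro: Dtilde_scale)
  then show ?thesis using Dtilde_finite_support by blast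
next
  case False
  then have c0: "c x = 0" for x using c_nonneg[of x] by (meson not_le order_antisym)
  obtain w :: 'x where True by simp
  define V where "V = {f \<in> Dtilde b c. f w = 0}"
  have "\<exists>K. \<forall>f\<in>V. \<forall>x. cmod (f x) \<le> K * sqrt (energy f)"
  proof (rule uniform_bound_of_pointwise_bound)
    fix x
    obtain K where K: "\<And>f. f \<in> Dtilde b c \<Longrightarrow> cmod (f x - f w) \<le> K * sqrt (energy f)"
      using pointwise_difference_bound by blast
    then show "\<exists>K. \<forall>f\<in>V. cmod (f x) \<le> K * sqrt (energy f)"
      unfolding V_def by force
  qed (auto simp: V_def intro: Dtilde_scale)
  then obtain K where K: "\<And>f x. f \<in> V \<Longrightarrow> cmod (f x) \<le> K * sqrt (energy f)" by blast
  have "cmod (g x) \<le> (2 * K) * sqrt (energy g)" if g: "finite {x. g x \<noteq> 0}" for g x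
  proof -
    have "c summable_on UNIV" by (simp add: c0[abs_def])
    then have "(\<lambda>x. g x - g w) \<in> Dtilde b c"
      by (intro Dtilde_diff Dtilde_finite_support g Dtilde_const)
    then have V: "(\<lambda>x. g x - g w) \<in> V" by (simp add: V_def)
    have "energy (\<lambda>x. g x - g w) = energy g" by (simp add: energy_def c0)
    then have le: "cmod (g x - g w) \<le> K * sqrt (energy g)" for x
      using K[OF V, of x] by simp
    \<comment> \<open>At a zero of g the normalised bound controls g w itself; adding it back
      doubles the constant.\<close>
    obtain v where "g v = 0" using ex_new_if_finite[OF infinite_UNIV g] by blast
    then have "cmod (g w) \<le> K * sqrt (energy g)" using le[of v] by simp
    then show ?thesis
      using le[of x] norm_triangle_ineq[of "g x - g w" "g w"] by simp
  qed
  then show ?thesis by blast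
qed

section \<open>The Dirichlet problem\<close>

lemma dirichlet_problem_Dtilde:
  assumes f: "f \<in> Dtilde b c"
  shows "\<exists>u\<in>Aalg b c. (\<forall>x. Lap b c u x = 0) \<and> (\<forall>\<gamma>\<in>boundary b c. \<gamma> u = \<gamma> f)"
proof -
  define C where "C = {g :: 'x \<Rightarrow> complex. finite {x. g x \<noteq> 0}}"
  have CD: "g \<in> Dtilde b c" if "g \<in> C" for g using that Dtilde_finite_support by (simp add: C_def)
  have Csub: "h \<in> C" if "g \<in> C" "g' \<in> C" "\<And>x. g x = 0 \<Longrightarrow> g' x = 0 \<Longrightarrow> h x = 0" for g g' h
  proof -
    have "{x. h x \<noteq> 0} \<subseteq> {x. g x \<noteq> 0} \<union> {x. g' x \<noteq> 0}" using that(3) by auto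
    then show ?thesis using that(1,2) finite_subset unfolding C_def by blast
  qed
  have Cpoint: "point x \<in> C" for x by (simp add: C_def point_def)
  define E where "E = (\<lambda>g. energy (\<lambda>x. f x - g x)) ` C"
  define m where "m = Inf E"
  have "(\<lambda>_. 0) \<in> C" by (simp add: C_def)
  then have Ene: "E \<noteq> {}" by (auto simp: E_def)
  have Ebdd: "bdd_below E" by (auto simp: E_def intro!: bdd_belowI2 energy_nonneg)
  have m_le: "m \<le> energy (\<lambda>x. f x - g x)" if "g \<in> C" for g
    unfolding m_def using that by (intro cInf_lower Ebdd) (auto simp: E_def)
  have "\<exists>g\<in>C. energy (\<lambda>x. f x - g x) < m + inverse (real (Suc n))" for n
    using cInf_lessD[OF Ene, of "m + inverse (real (Suc n))"] by (auto simp: m_def E_def)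
  then obtain g where gC: "\<And>n. g n \<in> C"
    and g: "\<And>n. energy (\<lambda>x. f x - g n x) < m + inverse (real (Suc n))" by metis
  define h where "h n = (\<lambda>x. f x - g n x)" for n
  have hD: "h n \<in> Dtilde b c" for n unfolding h_def by (rule Dtilde_diff[OF f CD[OF gC]])
  have hm: "energy (h n) < m + inverse (real (Suc n))" for n using g by (simp add: h_def)
  have diff_energy: "energy (\<lambda>x. h k x - h n x) \<le> 2 * inverse (real (Suc k)) + 2 * inverse (real (Suc n))" for k n
  proof -
    \<comment> \<open>The midpoint is again a competitor, so h k + h n has energy at least 4 m; the
      parallelogram law leaves only the excesses over m for the difference.\<close>
    define a where "a = (\<lambda>x. (1/2) * (g k x + g n x))"
    have "a \<in> C" by (rule Csub[OF gC[of k] gC[of n]]) (simp add: a_def)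
    have "(\<lambda>x. h k x + h n x) = (\<lambda>x. 2 * (f x - a x))"
      by (simp add: h_def a_def algebra_simps)
    then have "energy (\<lambda>x. h k x + h n x) = 4 * energy (\<lambda>x. f x - a x)"
      using energy_scale[of 2 "\<lambda>x. f x - a x"] by simp
    then have "energy (\<lambda>x. h k x + h n x) \<ge> 4 * m" using m_le[OF \<open>a \<in> C\<close>] by simp
    then show ?thesis using energy_parallelogram[OF hD[of k] hD[of n]] hm[of k] hm[of n] by linarith
  qed
  obtain K where K: "\<And>v x. v \<in> C \<Longrightarrow> cmod (v x) \<le> K * sqrt (energy v)"
    using finite_support_bound unfolding C_def by blast
  have lim: "(\<lambda>n. inverse (real (Suc n))) \<longlonglongrightarrow> 0" by (rule LIMSEQ_inverse_real_of_nat)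
  show ?thesis
  proof (rule harmonic_limit[of h])
    show "h n \<in> Aalg b c" for n using hD Dtilde_subset_Aalg by blast
    show "\<exists>N. \<forall>k\<ge>N. \<forall>n\<ge>N. \<forall>x. cmod (h k x - h n x) \<le> e" if "e > 0" for e
    proof -
      \<comment> \<open>From index N on, the difference has energy at most 4 d, whose square root
        times K is at most e.\<close>
      define d where "d = (e / (\<bar>K\<bar> + 1))\<^sup>2 / 4"
      have "d > 0" using \<open>e > 0\<close> by (simp add: d_def add_nonneg_eq_0_iff)
      then have "\<forall>\<^sub>F n in sequentially. inverse (real (Suc n)) < d"
        by (intro order_tendstoD(2)[OF lim])
      then obtain N where N: "\<And>n. n \<ge> N \<Longrightarrow> inverse (real (Suc n)) < d"
        by (auto simp: eventually_sequentially)
      have "cmod (h k x - h n x) \<le> e" if "k \<ge> N" "n \<ge> N" for k n x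
      proof -
        \<comment> \<open>f cancels in the difference, so the bound for finitely supported functions
          applies although h n itself need not have finite support.\<close>
        have C: "(\<lambda>x. h k x - h n x) \<in> C"
          by (rule Csub[OF gC[of k] gC[of n]]) (simp add: h_def)
        have "energy (\<lambda>x. h k x - h n x) \<le> (e / (\<bar>K\<bar> + 1))\<^sup>2"
          using diff_energy[of k n] N[OF that(1)] N[OF that(2)] unfolding d_def by linarith
        then have "sqrt (energy (\<lambda>x. h k x - h n x)) \<le> e / (\<bar>K\<bar> + 1)"
          using \<open>e > 0\<close> by (intro real_le_lsqrt) auto
        then have "K * sqrt (energy (\<lambda>x. h k x - h n x)) \<le> (\<bar>K\<bar> + 1) * (e / (\<bar>K\<bar> + 1))"
          by (intro mult_mono) (auto intro: energy_nonneg)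
        also have "\<dots> = e" by (simp add: add_nonneg_eq_0_iff)
        finally show ?thesis using K[OF C, of x] by simp
      qed
      then show ?thesis by blast
    qed
    show "(\<lambda>n. Lap b c (h n) x) \<longlonglongrightarrow> 0" for x
    proof -
      have le: "norm ((cmod (Lap b c (h n) x))\<^sup>2) \<le> inverse (real (Suc n)) * (deg x + 1)" for n
      proof -
        have "m \<le> energy (\<lambda>y. h n y + a * point x y)" for a
        proof -
          \<comment> \<open>A one-point perturbation of h n is absorbed into the competitor g n, so
            m bounds its energy from below.\<close>
          have "(\<lambda>y. g n y - a * point x y) \<in> C"
            by (rule Csub[OF gC[of n] Cpoint[of x]]) simp
          from m_le[OF this] show ?thesis by (simp add: h_def algebra_simps)
        qed
        then have "(cmod (Lap b c (h n) x))\<^sup>2 \<le> (energy (h n) - m) * (deg x + 1)"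
          by (rule Lap_le_energy_excess[OF hD])
        also have "\<dots> \<le> inverse (real (Suc n)) * (deg x + 1)"
          using hm[of n] by (intro mult_right_mono) (auto simp: deg_def infsum_nonneg add_nonneg_nonneg)
        finally show ?thesis by simp
      qed
      have "(\<lambda>n. inverse (real (Suc n)) * (deg x + 1)) \<longlonglongrightarrow> 0"
        using tendsto_mult_right[OF lim, of "deg x + 1"] by (simp only: mult_zero_left)
      then have "(\<lambda>n. (cmod (Lap b c (h n) x))\<^sup>2) \<longlonglongrightarrow> 0"
        by (rule Lim_null_comparison[OF always_eventually[OF allI[OF le]]])
      then have "(\<lambda>n. sqrt ((cmod (Lap b c (h n) x))\<^sup>2)) \<longlonglongrightarrow> sqrt 0" by (rule tendsto_real_sqrt)
      then show ?thesis by (simp add: tendsto_norm_zero_iff)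
    qed
    show "(\<lambda>n. \<gamma> (h n)) \<longlonglongrightarrow> \<gamma> f" if \<gamma>: "\<gamma> \<in> boundary b c" for \<gamma>
    proof -
      have "\<gamma> (h n) = \<gamma> f" for n
      proof -
        have "f \<in> Aplus b c" "g n \<in> Aplus b c"
          using f CD[OF gC[of n]] Dtilde_subset_Aalg Aalg_subset_Aplus by blast+
        moreover have "\<gamma> (g n) = 0"
          using boundary_finite_support[OF _ \<gamma>] gC[of n] by (simp add: C_def)
        ultimately show ?thesis
          unfolding h_def by (simp add: char_diff[OF boundary_char[OF \<gamma>]])
      qed
      then show ?thesis by simp
    qed
  qed
qed

lemma dirichlet_problem:
  assumes \<phi>: "\<phi> \<in> C0_boundary b c"
  shows "\<exists>u\<in>Aalg b c. (\<forall>x. Lap b c u x = 0) \<and> (\<forall>\<gamma>\<in>boundary b c. \<gamma> u = \<phi> \<gamma>)"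
proof -
  define \<epsilon> where "\<epsilon> n = inverse (real (Suc n))" for n
  have lim: "\<epsilon> \<longlonglongrightarrow> 0" unfolding \<epsilon>_def[abs_def] by (rule LIMSEQ_inverse_real_of_nat)
  have "\<exists>u. u \<in> Aalg b c \<and> (\<forall>x. Lap b c u x = 0) \<and> (\<forall>\<gamma>\<in>boundary b c. cmod (\<gamma> u - \<phi> \<gamma>) \<le> \<epsilon> n)" for n
  proof -
    obtain f where f: "f \<in> Dtilde b c" "\<forall>\<gamma>\<in>boundary b c. cmod (\<gamma> f - \<phi> \<gamma>) \<le> \<epsilon> n"
      using Dtilde_dense_in_C0_boundary[OF \<phi>, of "\<epsilon> n"] by (auto simp: \<epsilon>_def)
    then show ?thesis using dirichlet_problem_Dtilde[OF f(1)] by force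
  qed
  then obtain u where u: "\<And>n. u n \<in> Aalg b c" "\<And>n x. Lap b c (u n) x = 0"
    "\<And>n \<gamma>. \<gamma> \<in> boundary b c \<Longrightarrow> cmod (\<gamma> (u n) - \<phi> \<gamma>) \<le> \<epsilon> n" by metis
  have up: "u n \<in> Aplus b c" "u n \<in> linfty" for n
    using u(1) Aalg_subset_Aplus Aalg_linfty by blast+
  have dist: "cmod (u k x - u n x) \<le> \<epsilon> k + \<epsilon> n" for k n x
  proof (rule maximum_principle[where u = "\<lambda>x. u k x - u n x"])
    show "(\<lambda>x. u k x - u n x) \<in> Aalg b c" by (rule Aalg_diff[OF u(1) u(1)])
    show "Lap b c (\<lambda>x. u k x - u n x) y = 0" for y by (simp add: Lap_diff up u(2))
    fix \<gamma> assume \<gamma>: "\<gamma> \<in> boundary b c"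
    have "\<gamma> (\<lambda>x. u k x - u n x) = (\<gamma> (u k) - \<phi> \<gamma>) - (\<gamma> (u n) - \<phi> \<gamma>)"
      by (simp add: char_diff[OF boundary_char[OF \<gamma>] up(1) up(1)])
    then show "cmod (\<gamma> (\<lambda>x. u k x - u n x)) \<le> \<epsilon> k + \<epsilon> n"
      using norm_triangle_ineq4[of "\<gamma> (u k) - \<phi> \<gamma>" "\<gamma> (u n) - \<phi> \<gamma>"] u(3)[OF \<gamma>, of k] u(3)[OF \<gamma>, of n]
      by (simp only:)
  qed
  show ?thesis
  proof (rule harmonic_limit[of u])
    show "\<exists>N. \<forall>k\<ge>N. \<forall>n\<ge>N. \<forall>x. cmod (u k x - u n x) \<le> e" if "e > 0" for e
    proof -
      have "\<forall>\<^sub>F n in sequentially. \<epsilon> n < e/2"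
        using \<open>e > 0\<close> by (intro order_tendstoD(2)[OF lim]) simp
      then obtain N where N: "\<And>n. n \<ge> N \<Longrightarrow> \<epsilon> n < e/2"
        by (auto simp: eventually_sequentially)
      have "cmod (u k x - u n x) \<le> e" if "k \<ge> N" "n \<ge> N" for k n x
        using dist[of k x n] N[OF that(1)] N[OF that(2)] by linarith
      then show ?thesis by blast
    qed
    show "(\<lambda>n. \<gamma> (u n)) \<longlonglongrightarrow> \<phi> \<gamma>" if \<gamma>: "\<gamma> \<in> boundary b c" for \<gamma>
      using u(3)[OF \<gamma>] by (intro LIM_zero_cancel[OF Lim_null_comparison[OF _ lim]]) auto
  qed (use u in auto)
qed

lemma dirichlet_unique:
  assumes u: "u \<in> Aalg b c" "\<And>x. Lap b c u x = 0" and v: "v \<in> Aalg b c" "\<And>x. Lap b c v x = 0"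
    and eq: "\<And>\<gamma>. \<gamma> \<in> boundary b c \<Longrightarrow> \<gamma> u = \<gamma> v"
  shows "u = v"
proof
  fix x
  have mem: "u \<in> Aplus b c" "u \<in> linfty" "v \<in> Aplus b c" "v \<in> linfty"
    using u(1) v(1) Aalg_subset_Aplus Aalg_linfty by blast+
  have "cmod (u x - v x) \<le> 0"
  proof (rule maximum_principle[where u = "\<lambda>x. u x - v x"])
    show "(\<lambda>x. u x - v x) \<in> Aalg b c" by (rule Aalg_diff[OF u(1) v(1)])
    show "Lap b c (\<lambda>x. u x - v x) y = 0" for y by (simp add: Lap_diff mem u(2) v(2))
    show "cmod (\<gamma> (\<lambda>x. u x - v x)) \<le> 0" if "\<gamma> \<in> boundary b c" for \<gamma>
      by (simp add: char_diff[OF boundary_char[OF that] mem(1,3)] eq[OF that])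
  qed
  then show "u x = v x" by simp
qed

end

theorem mainTheorem13:
  fixes b :: "'x \<Rightarrow> 'x \<Rightarrow> real" and c :: "'x \<Rightarrow> real"
    and \<phi> :: "(('x \<Rightarrow> complex) \<Rightarrow> complex) \<Rightarrow> complex"
  assumes "countable (UNIV :: 'x set)" and "infinite (UNIV :: 'x set)"
    and "weighted_graph b c" and "graph_connected b"
    and "canonically_compactifiable b c"
    and "\<phi> \<in> C0_boundary b c"
  shows "\<exists>!u. u \<in> Aalg b c \<and> (\<forall>x. Lap b c u x = 0) \<and> (\<forall>\<gamma>\<in>boundary b c. \<gamma> u = \<phi> \<gamma>)"
proof -
  interpret compactifiable_graph b c
    using assms by unfold_locales
  obtain u where u: "u \<in> Aalg b c" "\<And>x. Lap b c u x = 0" "\<And>\<gamma>. \<gamma> \<in> boundary b c \<Longrightarrow> \<gamma> u = \<phi> \<gamma>"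
    using dirichlet_problem[OF assms(6)] by blast
  show ?thesis
  proof (rule ex1I[of _ u])
    fix v assume "v \<in> Aalg b c \<and> (\<forall>x. Lap b c v x = 0) \<and> (\<forall>\<gamma>\<in>boundary b c. \<gamma> v = \<phi> \<gamma>)"
    then show "v = u" using u by (intro dirichlet_unique) auto
  qed (use u in blast)
qed

end
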